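(* For all positive integers $d\le m$, $r$ and every $\varepsilon>0$, $$\mathbf{n}_\infty(d,m,r,\varepsilon)\le\mathbf{GR}\Big(\big\lfloor(1+4\varepsilon^{-1})^d\big\rfloor,\ \big\lfloor(1+4\varepsilon^{-1})^d\big\rfloor\,2^d\,\frac{m!}{(m-d)!},\ r\Big).$$
   Context: Spaces are real. $\ell_\infty^k=(\mathbb{R}^k,\|\cdot\|_\infty)$. $\mathrm{Emb}(\ell_\infty^a,\ell_\infty^b)$ is the set of linear isometric embeddings, with the operator-norm metric. An $r$-coloring is a map into $\{0,\dots,r-1\}$; a subset $F$ of the colored space $M$ is $\varepsilon$-monochromatic if for some color $i$ every element of $F$ is within distance $\varepsilon$ of an element of $M$ of color $i$. $\mathbf{n}_\infty(d,m,r,\varepsilon)$ is the least $n$ such that every $r$-coloring of $\mathrm{Emb}(\ell_\infty^d,\ell_\infty^n)$ has an $\varepsilon$-monochromatic set of the form $\gamma\circ\mathrm{Emb}(\ell_\infty^d,\ell_\infty^m)$ for some $\gamma\in\mathrm{Emb}(\ell_\infty^m,\ell_\infty^n)$. For finite linear orders $R,S$, a rigid surjection $f:R\to S$ is a surjection with $\min f^{-1}(s_0)<\min f^{-1}(s_1)$ whenever $s_0<s_1$; $\mathrm{Epi}(R,S)$ is the set of rigid surjections, and integers are naturally ordered as $\{0,\dots,a-1\}$. $\mathbf{GR}(a,b,r)$ is the least $n$ such that every $r$-coloring of $\mathrm{Epi}(n,a)$ is constant on a set of the form $\mathrm{Epi}(b,a)\circ\gamma$ for some $\gamma\in\mathrm{Epi}(n,b)$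 (Dual Ramsey Theorem of Graham–Rothschild). *)

theory Defs
  imports Complex_Main
begin

text \<open>Vectors of l_infinity^k are represented by functions nat => real, of which only
  the coordinates below k matter. A linear map l_infinity^a -> l_infinity^b is represented
  by its (b x a) matrix, given as a function nat => nat => real vanishing outside
  the index box {..<b} x {..<a}; this makes the representation canonical.\<close>

definition supnorm :: "nat \<Rightarrow> (nat \<Rightarrow> real) \<Rightarrow> real" where
  "supnorm k x = Max (insert 0 ((\<lambda>i. \<bar>x i\<bar>) ` {..<k}))"

definition mat_apply :: "nat \<Rightarrow> (nat \<Rightarrow> nat \<Rightarrow> real) \<Rightarrow> (nat \<Rightarrow> real) \<Rightarrow> (nat \<Rightarrow> real)" where
  "mat_apply a M x = (\<lambda>i. \<Sum>j<a. M i j * x j)"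

definition Emb :: "nat \<Rightarrow> nat \<Rightarrow> (nat \<Rightarrow> nat \<Rightarrow> real) set" where
  "Emb a b = {M. (\<forall>i j. (b \<le> i \<or> a \<le> j) \<longrightarrow> M i j = 0) \<and>
                  (\<forall>x. supnorm b (mat_apply a M x) = supnorm a x)}"

definition opnorm :: "nat \<Rightarrow> nat \<Rightarrow> (nat \<Rightarrow> nat \<Rightarrow> real) \<Rightarrow> real" where
  "opnorm a b M = Sup {supnorm b (mat_apply a M x) | x. supnorm a x \<le> 1}"

definition opdist :: "nat \<Rightarrow> nat \<Rightarrow> (nat \<Rightarrow> nat \<Rightarrow> real) \<Rightarrow> (nat \<Rightarrow> nat \<Rightarrow> real) \<Rightarrow> real" where
  "opdist a b M N = opnorm a b (\<lambda>i j. M i j - N i j)"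

definition mat_comp :: "nat \<Rightarrow> (nat \<Rightarrow> nat \<Rightarrow> real) \<Rightarrow> (nat \<Rightarrow> nat \<Rightarrow> real) \<Rightarrow> (nat \<Rightarrow> nat \<Rightarrow> real)" where
  "mat_comp m G P = (\<lambda>i j. \<Sum>k<m. G i k * P k j)"

definition emb_ramsey :: "nat \<Rightarrow> nat \<Rightarrow> nat \<Rightarrow> real \<Rightarrow> nat \<Rightarrow> bool" where
  "emb_ramsey d m r \<epsilon> n \<longleftrightarrow>
     (\<forall>c :: (nat \<Rightarrow> nat \<Rightarrow> real) \<Rightarrow> nat. (\<forall>M\<in>Emb d n. c M < r) \<longrightarrow>
        (\<exists>\<gamma>\<in>Emb m n. \<exists>i<r. \<forall>\<phi>\<in>Emb d m.
            \<exists>N\<in>Emb d n. c N = i \<and> opdist d n (mat_comp m \<gamma> \<phi>) N \<le> \<epsilon>))"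

definition n_inf :: "nat \<Rightarrow> nat \<Rightarrow> nat \<Rightarrow> real \<Rightarrow> nat" where
  "n_inf d m r \<epsilon> = (LEAST n. emb_ramsey d m r \<epsilon> n)"

text \<open>Epi(n,a): rigid surjections {..<n} -> {..<a}, represented by functions nat => nat
  that are 0 outside {..<n} (canonical representation).\<close>
definition Epi :: "nat \<Rightarrow> nat \<Rightarrow> (nat \<Rightarrow> nat) set" where
  "Epi n a = {f. f ` {..<n} = {..<a} \<and> (\<forall>j. n \<le> j \<longrightarrow> f j = 0) \<and>
                 (\<forall>s0 s1. s0 < s1 \<and> s1 < a \<longrightarrow>
                    Min {j. j < n \<and> f j = s0} < Min {j. j < n \<and> f j = s1})}"

definition epi_comp :: "nat \<Rightarrow> (nat \<Rightarrow> nat) \<Rightarrow> (nat \<Rightarrow> nat) \<Rightarrow> (nat \<Rightarrow> nat)" where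
  "epi_comp n f g = (\<lambda>j. if j < n then f (g j) else 0)"

definition gr_prop :: "nat \<Rightarrow> nat \<Rightarrow> nat \<Rightarrow> nat \<Rightarrow> bool" where
  "gr_prop a b r n \<longleftrightarrow>
     (\<forall>c :: (nat \<Rightarrow> nat) \<Rightarrow> nat. (\<forall>g\<in>Epi n a. c g < r) \<longrightarrow>
        (\<exists>\<gamma>\<in>Epi n b. \<exists>i. \<forall>f\<in>Epi b a. c (epi_comp n f \<gamma>) = i))"

definition GR :: "nat \<Rightarrow> nat \<Rightarrow> nat \<Rightarrow> nat" where
  "GR a b r = (LEAST n. gr_prop a b r n)"

end

theory Submission
  imports Defs "HOL-Analysis.Analysis"
begin

text \<open>
  The rows of the matrix of an isometric embedding \<open>\<ell>\<^sub>\<infinity>\<^sup>d \<rightarrow> \<ell>\<^sub>\<infinity>\<^sup>n\<close> are vectors of the unit ball of \<open>\<ell>\<^sub>1\<^sup>d\<close>, and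
  every unit vector occurs among them up to sign. A volume count gives an \<open>\<epsilon>/2\<close>-net \<open>D\<close> of this ball, sorted
  by norm, with \<open>a = \<lfloor>(1 + 4/\<epsilon>)\<^sup>d\<rfloor>\<close> entries including the unit vectors, so a rigid surjection
  \<open>g \<in> Epi(n, a)\<close> yields the embedding with rows \<open>D (g i)\<close>. Placing the net points into \<open>\<ell>\<^sub>1\<^sup>m\<close> along all
  signed injections of coordinates gives \<open>b = a \<cdot> 2\<^sup>d \<cdot> m!/(m-d)!\<close> vectors, and composing with an
  embedding \<open>\<phi>\<close> maps at least one copy of the net identically back to the net. Rounding the images of the other
  copies to earlier net points produces a rigid surjection \<open>b \<rightarrow> a\<close>, so a monochromatic family of
  rigid surjections transfers to an \<open>\<epsilon>\<close>-monochromatic family of embeddings.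

  Since \<open>GR\<close> is a least number, the argument also needs the Graham--Rothschild theorem itself. It is proved for
  parameter words by induction on the number of parameters. After passing to a subword, the
  colour depends only on the letters before the first parameter, then (by Hales--Jewett) only on
  their number, and a pigeonhole argument makes it constant.
\<close>

subsection \<open>Ramsey families\<close>

text \<open>Relations rather than sets allow conclusions such as ``the colour depends only on the length''.\<close>

definition ramsey_family :: "nat \<Rightarrow> ('a \<times> 'a) set set \<Rightarrow> bool" where
  "ramsey_family r \<E> \<longleftrightarrow> (\<forall>c::'a \<Rightarrow> nat. (\<forall>x. c x < r) \<longrightarrow> (\<exists>E\<in>\<E>. \<forall>(x,y)\<in>E. c x = c y))"

lemma ramsey_familyD:
  assumes "ramsey_family r \<E>" "\<And>x. c x < r"
  obtains E where "E \<in> \<E>" "\<And>x y. (x,y) \<in> E \<Longrightarrow> c x = c y"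
  using assms unfolding ramsey_family_def by blast

text \<open>The colours for all \<open>z \<in> Z\<close> are packed into a single colouring by
  functions from \<open>Z\<close> to \<open>{..<r}\<close>, of which there are
  \<open>r ^ card Z\<close>; the bijection \<open>h\<close> turns them into numbers.\<close>

lemma ramsey_family_simultaneous:
  assumes PP: "ramsey_family (r ^ card Z) \<E>" and fin: "finite Z" and c: "\<And>z x. c z x < r"
  obtains E where "E \<in> \<E>" "\<And>z x y. z \<in> Z \<Longrightarrow> (x,y) \<in> E \<Longrightarrow> c z x = c z y"
proof -
  let ?F = "Z \<rightarrow>\<^sub>E {..<r}"
  have finF: "finite ?F" and cardF: "card ?F = r ^ card Z"
    using fin by (auto simp: finite_PiE card_PiE)
  obtain h where h: "bij_betw h ?F {0..<card ?F}"
    using ex_bij_betw_finite_nat[OF finF] by blast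
  define g where "g x = (\<lambda>z\<in>Z. c z x)" for x
  have gF: "g x \<in> ?F" for x using c by (auto simp: g_def)
  have "h (g x) < r ^ card Z" for x
    using h gF[of x] cardF by (auto simp: bij_betw_def)
  then obtain E where E: "E \<in> \<E>" "\<And>x y. (x,y) \<in> E \<Longrightarrow> h (g x) = h (g y)"
    using ramsey_familyD[OF PP, of "\<lambda>x. h (g x)"] by blast
  show ?thesis
  proof (rule that[OF E(1)])
    fix z x y assume "z \<in> Z" "(x,y) \<in> E"
    then have "g x = g y" using E(2) h gF by (metis bij_betw_def inj_onD)
    then show "c z x = c z y" using \<open>z \<in> Z\<close> by (metis g_def restrict_apply')
  qed
qed

subsection \<open>The Hales--Jewett theorem\<close>

text \<open>The entries \<open>None\<close> are the active coordinates of a combinatorial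
  line.\<close>

definition fill :: "'a \<Rightarrow> 'a option list \<Rightarrow> 'a list" where
  "fill a l = map (case_option a id) l"

lemma fill_simps [simp]: "length (fill a l) = length l" "fill a (l @ l') = fill a l @ fill a l'"
  "fill a (map Some w) = w"
  by (simp_all add: fill_def comp_def)

definition comb_line :: "nat \<Rightarrow> nat \<Rightarrow> nat option list \<Rightarrow> bool" where
  "comb_line t n l \<longleftrightarrow> length l = n \<and> None \<in> set l \<and> set l \<subseteq> insert None (Some ` {..<t})"

text \<open>Relating all pairs of points of a line makes \<open>ramsey_family r (lines t n)\<close>
  the Hales--Jewett statement for \<open>r\<close> colours, alphabet \<open>{..<t}\<close> and
  dimension \<open>n\<close>.\<close>

definition lines :: "nat \<Rightarrow> nat \<Rightarrow> (nat list \<times> nat list) set set" where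
  "lines t n = (\<lambda>l. {(fill a l, fill b l) | a b. a < t \<and> b < t}) ` {l. comb_line t n l}"

lemma lines_obtain:
  assumes "E \<in> lines t n"
  obtains l where "comb_line t n l" "\<And>a b. a < t \<Longrightarrow> b < t \<Longrightarrow> (fill a l, fill b l) \<in> E"
  using assms unfolding lines_def by blast

lemma fill_set:
  assumes "comb_line t n l" "a < s" "t \<le> s"
  shows "set (fill a l) \<subseteq> {..<s}"
  using assms by (force simp: comb_line_def fill_def)

text \<open>Colour focusing: \<open>s\<close> lines, constant with distinct colours on the letters below \<open>t\<close>, share
  their endpoint for the letter \<open>t\<close>.\<close>

definition focused :: "nat \<Rightarrow> nat \<Rightarrow> nat \<Rightarrow> (nat list \<Rightarrow> nat) \<Rightarrow> nat \<Rightarrow> bool" where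
  "focused t n s c r \<longleftrightarrow>
     (\<exists>C f \<Lambda>. card C = s \<and> C \<subseteq> {..<r} \<and> length f = n \<and> set f \<subseteq> {..<Suc t} \<and>
        (\<forall>i\<in>C. comb_line (Suc t) n (\<Lambda> i) \<and> fill t (\<Lambda> i) = f \<and> (\<forall>a<t. c (fill a (\<Lambda> i)) = i)))"

definition mono_line :: "nat \<Rightarrow> nat \<Rightarrow> (nat list \<Rightarrow> nat) \<Rightarrow> bool" where
  "mono_line t n c \<longleftrightarrow> (\<exists>l. comb_line t n l \<and> (\<forall>a<t. \<forall>b<t. c (fill a l) = c (fill b l)))"

lemma comb_line_append:
  assumes "comb_line s h l" "s \<le> t" "length m = n" "set m \<subseteq> insert None (Some ` {..<t})"
  shows "comb_line t (h + n) (l @ m)"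
  using assms by (auto simp: comb_line_def image_iff subset_iff)

lemma comb_line_prepend_word:
  assumes "comb_line t n l" "length w = h" "set w \<subseteq> {..<t}"
  shows "comb_line t (h + n) (map Some w @ l)"
  using assms by (auto simp: comb_line_def)

text \<open>Hales--Jewett for \<open>t\<close> letters is applied to a new front block, with all
  suffixes in \<open>Z\<close> coloured at once. Moving along the resulting line \<open>l\<close>
  through the letters below \<open>t\<close> changes no colour, so \<open>foc\<close> can be used
  behind the fixed prefix \<open>fill 0 l\<close>.\<close>

lemma focused_extend:
  assumes t: "0 < t" and HJ: "\<And>r. \<exists>n. ramsey_family r (lines t n)"
    and foc: "\<And>c. (\<And>x. c x < r) \<Longrightarrow> mono_line (Suc t) n c \<or> focused t n s c r"
  shows "\<exists>n. \<forall>c. (\<forall>x. c x < r) \<longrightarrow> mono_line (Suc t) n c \<or> focused t n (Suc s) c r"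
proof -
  define Z where "Z = {z. set z \<subseteq> {..<Suc t} \<and> length z = n}"
  have finZ: "finite Z" unfolding Z_def by (rule finite_lists_length_eq) simp
  obtain h where h: "ramsey_family (r ^ card Z) (lines t h)" using HJ by blast
  show ?thesis
  proof (intro exI allI impI)
    fix c :: "nat list \<Rightarrow> nat" assume c: "\<forall>x. c x < r"
    obtain E where "E \<in> lines t h"
      and E: "\<And>z x y. z \<in> Z \<Longrightarrow> (x,y) \<in> E \<Longrightarrow> c (x @ z) = c (y @ z)"
      using ramsey_family_simultaneous[OF h finZ, of "\<lambda>z x. c (x @ z)"] c by blast
    then obtain l where l: "comb_line t h l" and lE: "\<And>a b. a < t \<Longrightarrow> b < t \<Longrightarrow> (fill a l, fill b l) \<in> E"
      by (meson lines_obtain)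
    have eq: "c (fill a l @ z) = c (fill 0 l @ z)" if "a < t" "z \<in> Z" for a z
      using E lE that t by blast
    have l0: "set (fill 0 l) \<subseteq> {..<Suc t}" "length (fill 0 l) = h"
      using fill_set[OF l, of 0 "Suc t"] l by (auto simp: comb_line_def)
    consider "mono_line (Suc t) n (\<lambda>z. c (fill 0 l @ z))" | "focused t n s (\<lambda>z. c (fill 0 l @ z)) r"
      using foc[of "\<lambda>z. c (fill 0 l @ z)"] c by blast
    then show "mono_line (Suc t) (h + n) c \<or> focused t (h + n) (Suc s) c r"
    proof cases
      case 1
      then obtain m where m: "comb_line (Suc t) n m"
        "\<And>a b. a < Suc t \<Longrightarrow> b < Suc t \<Longrightarrow> c (fill 0 l @ fill a m) = c (fill 0 l @ fill b m)"
        unfolding mono_line_def by blast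
      have "comb_line (Suc t) (h + n) (map Some (fill 0 l) @ m)"
        by (rule comb_line_prepend_word[OF m(1) l0(2,1)])
      moreover have "c (fill a (map Some (fill 0 l) @ m)) = c (fill b (map Some (fill 0 l) @ m))"
        if "a < Suc t" "b < Suc t" for a b using m(2)[OF that] by simp
      ultimately show ?thesis unfolding mono_line_def by blast
    next
      case 2
      then obtain C f \<Lambda> where C: "card C = s" "C \<subseteq> {..<r}" and f: "length f = n" "set f \<subseteq> {..<Suc t}"
        and \<Lambda>: "\<And>i. i \<in> C \<Longrightarrow> comb_line (Suc t) n (\<Lambda> i)" "\<And>i. i \<in> C \<Longrightarrow> fill t (\<Lambda> i) = f"
          "\<And>i a. i \<in> C \<Longrightarrow> a < t \<Longrightarrow> c (fill 0 l @ fill a (\<Lambda> i)) = i"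
        unfolding focused_def by blast
      \<comment> \<open>The colour of the common endpoint decides. If it lies in \<open>C\<close>,
        the line of that colour is constant on all of \<open>{..<Suc t}\<close>; otherwise it is a
        new colour.\<close>
      define i0 where "i0 = c (fill 0 l @ f)"
      show ?thesis
      proof (cases "i0 \<in> C")
        case True
        have const: "c (fill 0 l @ fill a (\<Lambda> i0)) = i0" if "a < Suc t" for a
        proof (cases "a = t")
          case True then show ?thesis using \<Lambda>(2)[OF \<open>i0 \<in> C\<close>] by (simp add: i0_def)
        next
          case False then show ?thesis using \<Lambda>(3)[OF \<open>i0 \<in> C\<close>] that by simp
        qed
        have "comb_line (Suc t) (h + n) (map Some (fill 0 l) @ \<Lambda> i0)"
          by (rule comb_line_prepend_word[OF \<Lambda>(1)[OF True] l0(2,1)])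
        moreover have "c (fill a (map Some (fill 0 l) @ \<Lambda> i0)) = i0" if "a < Suc t" for a
          using const[OF that] by simp
        ultimately show ?thesis unfolding mono_line_def by metis
      next
        case False
        \<comment> \<open>The old lines now move jointly with \<open>l\<close>, and \<open>l\<close>
          followed by the fixed word \<open>f\<close> contributes the colour \<open>i0\<close>; all
          of them end in \<open>fill t l @ f\<close>.\<close>
        define \<Lambda>' where "\<Lambda>' i = l @ (if i = i0 then map Some f else \<Lambda> i)" for i
        have inZ: "fill a (\<Lambda> i) \<in> Z" if "i \<in> C" "a < t" for a i
          using fill_set[OF \<Lambda>(1)[OF that(1)], of a "Suc t"] \<Lambda>(1)[OF that(1)] that(2)
          by (auto simp: Z_def comb_line_def)
        have fZ: "f \<in> Z" using f by (simp add: Z_def)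
        have "comb_line (Suc t) (h + n) (\<Lambda>' i) \<and> fill t (\<Lambda>' i) = fill t l @ f \<and>
              (\<forall>a<t. c (fill a (\<Lambda>' i)) = i)" if i: "i \<in> insert i0 C" for i
        proof (cases "i = i0")
          case True
          have "comb_line (Suc t) (h + n) (l @ map Some f)"
            by (rule comb_line_append[OF l]) (use f in auto)
          moreover have "\<forall>a<t. c (fill a l @ f) = i" using eq[OF _ fZ] True unfolding i0_def by metis
          ultimately show ?thesis using True by (simp add: \<Lambda>'_def)
        next
          case False
          then have iC: "i \<in> C" using i by simp
          have "comb_line (Suc t) (h + n) (l @ \<Lambda> i)"
            by (rule comb_line_append[OF l]) (use \<Lambda>(1)[OF iC] in \<open>auto simp: comb_line_def\<close>)
          moreover have "\<forall>a<t. c (fill a l @ fill a (\<Lambda> i)) = i"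
            using eq[OF _ inZ[OF iC]] \<Lambda>(3)[OF iC] by metis
          ultimately show ?thesis using False \<Lambda>(2)[OF iC] by (simp add: \<Lambda>'_def)
        qed
        moreover have "card (insert i0 C) = Suc s"
          using C False finite_subset[OF C(2)] by simp
        moreover have "insert i0 C \<subseteq> {..<r}" using C(2) c by (auto simp: i0_def)
        moreover have "length (fill t l @ f) = h + n" "set (fill t l @ f) \<subseteq> {..<Suc t}"
          using f fill_set[OF l, of t "Suc t"] l by (auto simp: comb_line_def)
        ultimately show ?thesis unfolding focused_def by blast
      qed
    qed
  qed
qed

text \<open>Induction on the alphabet size. With \<open>r\<close> focused lines every colour is
  taken by one of them, including that of the common endpoint, and the line with this colour is
  constant on the larger alphabet.\<close>

theorem hales_jewett: "\<exists>n. ramsey_family r (lines t n)"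
proof (induction t arbitrary: r)
  case 0
  have "comb_line 0 1 [None]" by (simp add: comb_line_def)
  then show ?case by (intro exI[of _ 1]) (auto simp: ramsey_family_def lines_def)
next
  case (Suc t)
  show ?case
  \<comment> \<open>\<open>focused_extend\<close> uses the letter \<open>0\<close> below
    \<open>t\<close>, so the alphabet with a single letter is treated apart.\<close>
  proof (cases "t = 0")
    case True
    have "comb_line (Suc 0) 1 [None]" by (simp add: comb_line_def)
    then show ?thesis using True by (intro exI[of _ 1]) (auto simp: ramsey_family_def lines_def)
  next
    case False
    have "\<exists>n. \<forall>c. (\<forall>x. c x < r) \<longrightarrow> mono_line (Suc t) n c \<or> focused t n s c r" for s
    proof (induction s)
      case 0
      have "focused t 0 0 c r" for c
        unfolding focused_def by (intro exI[of _ "{}"] exI[of _ "[]"]) simp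
      then show ?case by blast
    next
      case (Suc s)
      then obtain n where "\<And>c. (\<And>x. c x < r) \<Longrightarrow> mono_line (Suc t) n c \<or> focused t n s c r" by blast
      then show ?case using focused_extend[of t r n s] Suc.prems False \<open>\<And>r. \<exists>n. ramsey_family r (lines t n)\<close>
        by blast
    qed
    then obtain n where n: "\<And>c. (\<forall>x. c x < r) \<Longrightarrow> mono_line (Suc t) n c \<or> focused t n r c r" by blast
    have mono: "mono_line (Suc t) n c" if c: "\<forall>x. c x < r" for c
    proof (rule ccontr)
      assume no: "\<not> mono_line (Suc t) n c"
      then obtain C f \<Lambda> where C: "card C = r" "C \<subseteq> {..<r}"
        and \<Lambda>: "\<And>i. i \<in> C \<Longrightarrow> comb_line (Suc t) n (\<Lambda> i)" "\<And>i. i \<in> C \<Longrightarrow> fill t (\<Lambda> i) = f"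
          "\<And>i a. i \<in> C \<Longrightarrow> a < t \<Longrightarrow> c (fill a (\<Lambda> i)) = i"
        using n[OF c] unfolding focused_def by blast
      have "C = {..<r}" using C by (simp add: card_subset_eq)
      then have i: "c f \<in> C" using c by simp
      have "c (fill a (\<Lambda> (c f))) = c f" if "a < Suc t" for a
        using \<Lambda>(2,3)[OF i] that by (cases "a = t") auto
      then show False using no \<Lambda>(1)[OF i] unfolding mono_line_def by auto
    qed
    have "ramsey_family r (lines (Suc t) n)"
      unfolding ramsey_family_def
    proof (intro allI impI)
      fix c :: "nat list \<Rightarrow> nat" assume "\<forall>x. c x < r"
      then obtain l where l: "comb_line (Suc t) n l"
        "\<forall>a<Suc t. \<forall>b<Suc t. c (fill a l) = c (fill b l)"
        using mono unfolding mono_line_def by blast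
      show "\<exists>E\<in>lines (Suc t) n. \<forall>(x, y)\<in>E. c x = c y"
        unfolding lines_def by (rule bexI[OF _ imageI[of l]]) (use l in auto)
    qed
    then show ?thesis ..
  qed
qed

subsection \<open>Parameter words\<close>

text \<open>A word over the alphabet \<open>{..<t}\<close> with the \<open>k\<close> parameters \<open>t, \<dots>, t + k - 1\<close>, whose first
  occurrences appear in increasing order. For \<open>t = 0\<close> these are the rigid surjections onto
  \<open>{..<k}\<close>, written as lists of values.\<close>

fun param_word :: "nat \<Rightarrow> nat \<Rightarrow> nat list \<Rightarrow> bool" where
  "param_word t k [] \<longleftrightarrow> k = 0"
| "param_word t k (x # w) \<longleftrightarrow>
     x < t \<and> param_word t k w \<or> x = t \<and> (\<exists>k'. k = Suc k' \<and> param_word (Suc t) k' w)"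

text \<open>Substitution is composition in disguise: for \<open>t = 0\<close> and lists of values
  \<open>u\<close>, \<open>w\<close> of rigid surjections, \<open>wsubst 0 u w\<close> lists the
  values of the surjection of \<open>u\<close> after that of \<open>w\<close>.\<close>

definition letter_subst :: "nat \<Rightarrow> nat list \<Rightarrow> nat \<Rightarrow> nat" where
  "letter_subst t u x = (if x < t then x else u ! (x - t))"

abbreviation wsubst :: "nat \<Rightarrow> nat list \<Rightarrow> nat list \<Rightarrow> nat list" where
  "wsubst t u w \<equiv> map (letter_subst t u) w"

definition words :: "nat \<Rightarrow> nat \<Rightarrow> nat \<Rightarrow> nat list set" where
  "words t k n = {w. length w = n \<and> param_word t k w}"

lemma param_word_set: "param_word t k w \<Longrightarrow> set w \<subseteq> {..<t + k}"
  by (induction w arbitrary: t k) fastforce+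

lemma param_word_append:
  assumes "set v \<subseteq> {..<t}"
  shows "param_word t k (v @ w) \<longleftrightarrow> param_word t k w"
  using assms by (induction v) auto

text \<open>Two alphabets are needed in the induction: the first parameter of \<open>w\<close>
  becomes a letter at its first occurrence, so \<open>s\<close> grows, while \<open>t\<close> grows
  only if the image is a new parameter as well.\<close>

lemma param_word_map:
  assumes "param_word s m w" "param_word t k u" "length u = m"
    "\<And>x. x < s \<Longrightarrow> g x < t" "\<And>i. i < m \<Longrightarrow> g (s + i) = u ! i"
  shows "param_word t k (map g w)"
  using assms
proof (induction w arbitrary: s m t k u)
  case Nil
  then show ?case by simp
next
  case (Cons x w)
  from Cons.prems(1) consider "x < s" "param_word s m w"
    | m' where "x = s" "m = Suc m'" "param_word (Suc s) m' w" by auto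
  then show ?case
  proof cases
    case 1
    then show ?thesis using Cons.IH[OF 1(2) Cons.prems(2-5)] Cons.prems(4) by simp
  next
    case 2
    then obtain y v where u: "u = y # v" "length v = m'" using Cons.prems(3) by (cases u) auto
    have gs: "g s = y" using Cons.prems(5)[of 0] 2 u by simp
    have gi: "g (Suc s + i) = v ! i" if "i < m'" for i
      using Cons.prems(5)[of "Suc i"] that 2 u by simp
    from Cons.prems(2) u(1) consider "y < t" "param_word t k v"
      | k' where "y = t" "k = Suc k'" "param_word (Suc t) k' v" by auto
    then show ?thesis
    proof cases
      case a: 1
      have "g x' < t" if "x' < Suc s" for x'
        using that Cons.prems(4) gs a by (cases "x' = s") auto
      then show ?thesis using Cons.IH[OF 2(3) a(2) u(2) _ gi] 2(1) gs a(1) by auto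
    next
      case a: 2
      have "g x' < Suc t" if "x' < Suc s" for x'
        using that Cons.prems(4)[of x'] gs a by (cases "x' = s") auto
      then show ?thesis using Cons.IH[OF 2(3) a(3) u(2) _ gi] 2(1) gs a(1,2) by auto
    qed
  qed
qed

lemma wsubst_words:
  assumes "w \<in> words t m n" "u \<in> words t k m"
  shows "wsubst t u w \<in> words t k n"
  using assms param_word_map[of t m w t k u "letter_subst t u"]
  by (auto simp: words_def letter_subst_def)

lemma wsubst_wsubst:
  assumes "set w \<subseteq> {..<t + length u}"
  shows "wsubst t v (wsubst t u w) = wsubst t (wsubst t v u) w"
  using assms by (auto simp: letter_subst_def subset_iff)

lemma words_set: "w \<in> words t k n \<Longrightarrow> set w \<subseteq> {..<t + k}"
  using param_word_set by (auto simp: words_def)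

lemma words_length: "w \<in> words t k n \<Longrightarrow> length w = n"
  by (simp add: words_def)

lemma wsubst_assoc:
  assumes "w \<in> words t m n" "u \<in> words t l m"
  shows "wsubst t v (wsubst t u w) = wsubst t (wsubst t v u) w"
  using assms words_set words_length by (intro wsubst_wsubst) blast

text \<open>Renaming the parameters frees the symbol \<open>t\<close>, which can then serve as an
  additional letter or as a new first parameter.\<close>

definition shift :: "nat \<Rightarrow> nat list \<Rightarrow> nat list" where
  "shift t w = map (\<lambda>x. if x < t then x else Suc x) w"

lemma param_word_shift:
  assumes "param_word s k w" "t \<le> s"
  shows "param_word (Suc s) k (shift t w)"
  using assms by (induction w arbitrary: s k) (auto simp: shift_def)

lemma shift_words: "w \<in> words t k n \<Longrightarrow> shift t w \<in> words (Suc t) k n"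
  using param_word_shift[of t k w t] by (simp add: words_def shift_def)

text \<open>The symbol \<open>t\<close> does not occur in \<open>shift t w\<close>, so its image
  \<open>a\<close> has no effect.\<close>

lemma wsubst_Cons_shift: "wsubst t (a # u) (shift t w) = wsubst t u w"
  by (auto simp: shift_def letter_subst_def)

text \<open>A parameter sent to itself behaves like a letter.\<close>

lemma letter_subst_Cons_param: "letter_subst t (t # u) = letter_subst (Suc t) u"
proof
  fix x show "letter_subst t (t # u) x = letter_subst (Suc t) u x"
    by (cases x t rule: linorder_cases) (auto simp: letter_subst_def nth_Cons')
qed

lemma words_Suc_cases:
  assumes "u \<in> words t k (Suc m)"
  obtains a u' where "u = a # u'" "a < t" "u' \<in> words t k m"
    | u' k' where "u = t # u'" "k = Suc k'" "u' \<in> words (Suc t) k' m"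
  using assms by (cases u) (auto simp: words_def)

lemma words_Cons_letter: "a < t \<Longrightarrow> w \<in> words t k n \<Longrightarrow> a # w \<in> words t k (Suc n)"
  by (simp add: words_def)

lemma words_Cons_param: "w \<in> words (Suc t) k n \<Longrightarrow> t # w \<in> words t (Suc k) (Suc n)"
  by (simp add: words_def)

lemma words_0_iff: "w \<in> words t k 0 \<longleftrightarrow> w = [] \<and> k = 0"
  by (auto simp: words_def)

section \<open>Ramsey statements for substitution into parameter words\<close>

text \<open>\<open>f\<close> is the part of a word that gets coloured, and \<open>Q\<close> selects
  the pairs that must agree. The Graham--Rothschild statement takes the identity and the trivial
  \<open>Q\<close>; the two intermediate statements restrict \<open>Q\<close>, and one of them
  colours only the letters before the first parameter.\<close>

definition gr_family ::
    "(nat list \<Rightarrow> 'b) \<Rightarrow> (nat list \<Rightarrow> nat list \<Rightarrow> bool) \<Rightarrow> nat \<Rightarrow> nat \<Rightarrow> nat \<Rightarrow> nat \<Rightarrow> ('b \<times> 'b) set set" where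
  "gr_family f Q t k m n =
     (\<lambda>w. {(f (wsubst t u w), f (wsubst t v w)) | u v.
              u \<in> words t k m \<and> v \<in> words t k m \<and> Q u v}) ` words t m n"

abbreviation "full_gr_family \<equiv> gr_family (\<lambda>w. w) (\<lambda>u v. True)"

lemma gr_familyI:
  assumes "\<And>c. (\<And>x. c x < r) \<Longrightarrow> \<exists>w\<in>words t m n. \<forall>u\<in>words t k m. \<forall>v\<in>words t k m. Q u v \<longrightarrow>
    c (f (wsubst t u w)) = c (f (wsubst t v w))"
  shows "ramsey_family r (gr_family f Q t k m n)"
  unfolding ramsey_family_def gr_family_def
proof (intro allI impI)
  fix c :: "'a \<Rightarrow> nat" assume "\<forall>x. c x < r"
  then obtain w where w: "w \<in> words t m n" "\<forall>u\<in>words t k m. \<forall>v\<in>words t k m. Q u v \<longrightarrow>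
    c (f (wsubst t u w)) = c (f (wsubst t v w))" using assms by blast
  show "\<exists>E\<in>(\<lambda>w. {(f (wsubst t u w), f (wsubst t v w)) |u v.
             u \<in> words t k m \<and> v \<in> words t k m \<and> Q u v}) `
             words t m n. \<forall>(x, y)\<in>E. c x = c y"
    by (rule bexI[OF _ imageI[OF w(1)]]) (use w(2) in auto)
qed

lemma gr_familyD_simultaneous:
  assumes "ramsey_family (r ^ card Z) (gr_family f Q t k m n)" "finite Z" "\<And>z x. c z x < r"
  obtains w where "w \<in> words t m n"
    "\<And>z u v. z \<in> Z \<Longrightarrow> u \<in> words t k m \<Longrightarrow> v \<in> words t k m \<Longrightarrow> Q u v \<Longrightarrow>
       c z (f (wsubst t u w)) = c z (f (wsubst t v w))"
proof -
  obtain E where E: "E \<in> gr_family f Q t k m n" "\<And>z x y. z \<in> Z \<Longrightarrow> (x,y) \<in> E \<Longrightarrow> c z x = c z y"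
    by (rule ramsey_family_simultaneous[where c = c, OF assms]) blast
  then obtain w where w: "w \<in> words t m n" and E_eq: "E = {(f (wsubst t u w), f (wsubst t v w)) | u v.
              u \<in> words t k m \<and> v \<in> words t k m \<and> Q u v}" unfolding gr_family_def by blast
  show ?thesis
    by (rule that[OF w], rule E(2)) (auto simp: E_eq)
qed

lemma gr_familyD:
  assumes "ramsey_family r (gr_family f Q t k m n)" "\<And>x. c x < r"
  obtains w where "w \<in> words t m n"
    "\<And>u v. u \<in> words t k m \<Longrightarrow> v \<in> words t k m \<Longrightarrow> Q u v \<Longrightarrow>
       c (f (wsubst t u w)) = c (f (wsubst t v w))"
  using gr_familyD_simultaneous[of r "{()}" f Q t k m n "\<lambda>_. c"] assms by auto

lemma full_gr_familyD_simultaneous: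
  assumes "ramsey_family (r ^ card Z) (full_gr_family t k m n)" "finite Z" "\<And>z x. c z x < r"
  obtains w where "w \<in> words t m n"
    "\<And>z u v. z \<in> Z \<Longrightarrow> u \<in> words t k m \<Longrightarrow> v \<in> words t k m \<Longrightarrow>
       c z (wsubst t u w) = c z (wsubst t v w)"
proof -
  obtain w where "w \<in> words t m n" "\<And>z u v. z \<in> Z \<Longrightarrow> u \<in> words t k m \<Longrightarrow> v \<in> words t k m \<Longrightarrow> True \<Longrightarrow>
       c z (wsubst t u w) = c z (wsubst t v w)"
    by (rule gr_familyD_simultaneous[where c = c, OF assms]) blast
  then show ?thesis by (intro that) simp_all
qed

lemma full_gr_familyD:
  assumes "ramsey_family r (full_gr_family t k m n)" "\<And>x. c x < r"
  obtains w where "w \<in> words t m n"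
    "\<And>u v. u \<in> words t k m \<Longrightarrow> v \<in> words t k m \<Longrightarrow> c (wsubst t u w) = c (wsubst t v w)"
  using full_gr_familyD_simultaneous[of r "{()}" t k m n "\<lambda>_. c"] assms by auto

lemma linesD_simultaneous:
  assumes "ramsey_family (r ^ card Z) (lines t h)" "finite Z" "\<And>z x. c z x < r"
  obtains l where "comb_line t h l"
    "\<And>z a b. z \<in> Z \<Longrightarrow> a < t \<Longrightarrow> b < t \<Longrightarrow> c z (fill a l) = c z (fill b l)"
proof -
  obtain E where E: "E \<in> lines t h" "\<And>z x y. z \<in> Z \<Longrightarrow> (x,y) \<in> E \<Longrightarrow> c z x = c z y"
    by (rule ramsey_family_simultaneous[where c = c, OF assms]) blast
  from E(1) obtain l where "comb_line t h l" "\<And>a b. a < t \<Longrightarrow> b < t \<Longrightarrow> (fill a l, fill b l) \<in> E"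
    by (rule lines_obtain) blast
  then show ?thesis using that E(2) by blast
qed

lemma linesD:
  assumes "ramsey_family r (lines t h)" "\<And>x. c x < r"
  obtains l where "comb_line t h l"
    "\<And>a b. a < t \<Longrightarrow> b < t \<Longrightarrow> c (fill a l) = c (fill b l)"
  using linesD_simultaneous[of r "{()}" t h "\<lambda>_. c"] assms by auto

text \<open>The active coordinates receive the new parameter \<open>t\<close>. Before the first of
  them only letters below \<open>t\<close> occur; after it \<open>t\<close> counts as a letter, so
  the parameters of \<open>w\<close> may follow.\<close>

lemma words_line_append:
  assumes l: "comb_line t h l" and w: "w \<in> words (Suc t) m n"
  shows "fill t l @ w \<in> words t (Suc m) (h + n)"
proof -
  have "param_word t (Suc m) (fill t l @ w)"
    if "set l \<subseteq> insert None (Some ` {..<t})" "None \<in> set l" for l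
    using that
  proof (induction l)
    case (Cons x l)
    show ?case
    proof (cases x)
      case None
      have "set (fill t l) \<subseteq> {..<Suc t}" using Cons.prems(1) by (auto simp: fill_def)
      then have "param_word (Suc t) m (fill t l @ w)"
        using w param_word_append[of "fill t l" "Suc t"] by (simp add: words_def)
      then show ?thesis using None by (simp add: fill_def)
    next
      case (Some a)
      then show ?thesis using Cons by (auto simp: fill_def)
    qed
  qed simp
  then show ?thesis using l w by (simp add: comb_line_def words_def)
qed

lemma wsubst_fill:
  assumes "comb_line t h l"
  shows "wsubst t (a # u) (fill t l) = fill a l"
  using assms by (auto simp: comb_line_def fill_def letter_subst_def subset_iff split: option.split)

subsection \<open>The Graham--Rothschild theorem\<close>

lemma finite_block: "finite {y :: nat list. set y \<subseteq> {..<t} \<and> length y = h}"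
  by (rule finite_lists_length_eq) simp

text \<open>This is the Hales--Jewett theorem for \<open>m\<close>-dimensional subspaces. The
  induction on \<open>m\<close> first makes the colour independent of the last parameters,
  simultaneously for all front blocks in \<open>Z\<close>, and then finds one line in the front
  block.\<close>

lemma gr_zero: "\<exists>n. ramsey_family r (full_gr_family t 0 m n)"
proof (induction m arbitrary: r)
  case 0
  have "ramsey_family r (full_gr_family t 0 0 0)"
    by (rule gr_familyI) (simp add: words_0_iff)
  then show ?case ..
next
  case (Suc m)
  obtain h where h: "ramsey_family r (lines t h)" using hales_jewett by blast
  define Z where "Z = {y :: nat list. set y \<subseteq> {..<t} \<and> length y = h}"
  have finZ: "finite Z" unfolding Z_def by (rule finite_block)
  obtain n where n: "ramsey_family (r ^ card Z) (full_gr_family t 0 m n)" using Suc by blast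
  have "ramsey_family r (full_gr_family t 0 (Suc m) (h + n))"
  proof (rule gr_familyI)
    fix c :: "nat list \<Rightarrow> nat" assume c: "\<And>x. c x < r"
    obtain w where w: "w \<in> words t m n"
      and wc: "\<And>y u v. y \<in> Z \<Longrightarrow> u \<in> words t 0 m \<Longrightarrow> v \<in> words t 0 m \<Longrightarrow>
                 c (y @ wsubst t u w) = c (y @ wsubst t v w)"
      using full_gr_familyD_simultaneous[OF n finZ, of "\<lambda>y x. c (y @ x)"] c by blast
    \<comment> \<open>Any fixed word of letters would do. The letter \<open>0\<close> exists only
      for positive \<open>t\<close>, so membership of \<open>u0\<close> is proved later, once a
      letter below \<open>t\<close> is at hand.\<close>
    define u0 where "u0 = replicate m (0::nat)"
    obtain l where l: "comb_line t h l"
      and E: "\<And>a b. a < t \<Longrightarrow> b < t \<Longrightarrow> c (fill a l @ wsubst t u0 w) = c (fill b l @ wsubst t u0 w)"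
      using linesD[OF h, of "\<lambda>x. c (x @ wsubst t u0 w)"] c by blast
    have fZ: "fill a l \<in> Z" if "a < t" for a
      using fill_set[OF l that] l by (auto simp: Z_def comb_line_def)
    let ?w = "fill t l @ shift t w"
    have "?w \<in> words t (Suc m) (h + n)" by (rule words_line_append[OF l shift_words[OF w]])
    moreover have "c (wsubst t u ?w) = c (wsubst t v ?w)"
      if u: "u \<in> words t 0 (Suc m)" and v: "v \<in> words t 0 (Suc m)" for u v
    proof -
      obtain a u' where u': "u = a # u'" "a < t" "u' \<in> words t 0 m"
        using u by (rule words_Suc_cases) auto
      obtain b v' where v': "v = b # v'" "b < t" "v' \<in> words t 0 m"
        using v by (rule words_Suc_cases) auto
      have "param_word t 0 (replicate j 0)" for j using u'(2) by (induction j) auto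
      then have u0: "u0 \<in> words t 0 m" by (simp add: u0_def words_def)
      have "c (wsubst t u ?w) = c (fill a l @ wsubst t u' w)"
        by (simp only: u'(1) map_append wsubst_fill[OF l] wsubst_Cons_shift)
      also have "\<dots> = c (fill a l @ wsubst t u0 w)" by (rule wc[OF fZ[OF u'(2)] u'(3) u0])
      also have "\<dots> = c (fill b l @ wsubst t u0 w)" by (rule E[OF u'(2) v'(2)])
      also have "\<dots> = c (fill b l @ wsubst t v' w)" by (rule wc[OF fZ[OF v'(2)] u0 v'(3)])
      also have "\<dots> = c (wsubst t v ?w)"
        by (simp only: v'(1) map_append wsubst_fill[OF l] wsubst_Cons_shift)
      finally show ?thesis .
    qed
    ultimately show "\<exists>w\<in>words t (Suc m) (h + n). \<forall>u\<in>words t 0 (Suc m). \<forall>v\<in>words t 0 (Suc m). True \<longrightarrow>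
       c (wsubst t u w) = c (wsubst t v w)" by blast
  qed
  then show ?case ..
qed

abbreviation head :: "nat \<Rightarrow> nat list \<Rightarrow> nat list" where
  "head t \<equiv> takeWhile (\<lambda>x. x < t)"

text \<open>The constructed word starts with the parameter \<open>t\<close>. If a substitution keeps
  this parameter, the head is empty and \<open>IH\<close> with the larger alphabet makes the colour
  constant; if it inserts a letter, the induction on \<open>m\<close> applies to the rest, for all
  letters at once.\<close>

lemma gr_constant_after_head:
  assumes IH: "\<And>m r. \<exists>n. ramsey_family r (full_gr_family (Suc t) k m n)"
  shows "\<exists>n. ramsey_family r (gr_family (\<lambda>w. w) (\<lambda>u v. head t u = head t v) t (Suc k) m n)"
proof (induction m arbitrary: r)
  case 0
  have "ramsey_family r (gr_family (\<lambda>w. w) (\<lambda>u v. head t u = head t v) t (Suc k) 0 0)"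
    by (rule gr_familyI) (simp add: words_0_iff)
  then show ?case ..
next
  case (Suc m)
  obtain m1 where m1: "ramsey_family (r ^ card {..<t})
      (gr_family (\<lambda>w. w) (\<lambda>u v. head t u = head t v) t (Suc k) m m1)"
    using Suc by blast
  obtain n where n: "ramsey_family r (full_gr_family (Suc t) k m1 n)" using IH by blast
  have "ramsey_family r (gr_family (\<lambda>w. w) (\<lambda>u v. head t u = head t v) t (Suc k) (Suc m) (Suc n))"
  proof (rule gr_familyI)
    fix c :: "nat list \<Rightarrow> nat" assume c: "\<And>x. c x < r"
    obtain w1 where w1: "w1 \<in> words (Suc t) m1 n"
      and w1c: "\<And>u v. u \<in> words (Suc t) k m1 \<Longrightarrow> v \<in> words (Suc t) k m1 \<Longrightarrow>
                 c (t # wsubst (Suc t) u w1) = c (t # wsubst (Suc t) v w1)"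
      using full_gr_familyD[OF n, of "\<lambda>x. c (t # x)"] c by blast
    obtain w2 where w2: "w2 \<in> words t m m1"
      and w2c: "\<And>a u v. a \<in> {..<t} \<Longrightarrow> u \<in> words t (Suc k) m \<Longrightarrow> v \<in> words t (Suc k) m \<Longrightarrow>
                 head t u = head t v \<Longrightarrow>
                 c (a # wsubst t (a # wsubst t u w2) w1) = c (a # wsubst t (a # wsubst t v w2) w1)"
      using gr_familyD_simultaneous[OF m1 finite_lessThan, of "\<lambda>a x. c (a # wsubst t (a # x) w1)"] c by blast
    \<comment> \<open>\<open>w1\<close> handles the substitutions that keep the first parameter, and
      \<open>w2\<close> inside it those that replace it by a letter \<open>a\<close>; in the latter
      case \<open>a\<close> also replaces the symbol \<open>t\<close> in \<open>w1\<close>.\<close>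
    define w where "w = wsubst (Suc t) (shift t w2) w1"
    have sw2: "shift t w2 \<in> words (Suc t) m m1" by (rule shift_words[OF w2])
    have w: "w \<in> words (Suc t) m n" unfolding w_def by (rule wsubst_words[OF w1 sw2])
    have param: "wsubst t (t # u) (t # w) = t # wsubst (Suc t) (wsubst (Suc t) u (shift t w2)) w1" for u
      using wsubst_assoc[OF w1 sw2, of u]
      by (simp add: letter_subst_Cons_param w_def del: map_map) (simp add: letter_subst_def)
    have len: "length (shift t w2) = m1" using sw2 words_length by blast
    have letter: "wsubst t (a # u) (t # w) = a # wsubst t (a # wsubst t u w2) w1" for a u
    proof -
      \<comment> \<open>Equality is claimed only for symbols that can occur in \<open>w1\<close>,
        since list access beyond the length is not controlled.\<close>
      have "letter_subst t (a # u) (letter_subst (Suc t) (shift t w2) x) =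
            letter_subst t (a # wsubst t u w2) x" if x: "x < Suc t + m1" for x
      proof (cases x t rule: linorder_cases)
        case greater
        then have i: "x - Suc t < length w2" using x len by (simp add: shift_def)
        have "letter_subst t (a # u) (shift t w2 ! (x - Suc t)) = letter_subst t u (w2 ! (x - Suc t))"
          using i arg_cong[OF wsubst_Cons_shift[of t a u w2], of "\<lambda>v. v ! (x - Suc t)"]
          by (simp add: shift_def)
        then show ?thesis using greater i by (simp add: letter_subst_def[of _ _ x] nth_Cons')
      qed (auto simp: letter_subst_def)
      then show ?thesis using words_set[OF w1] by (auto simp: w_def letter_subst_def[of t "a # u" t])
    qed
    have "c (wsubst t u (t # w)) = c (wsubst t v (t # w))"
      if u: "u \<in> words t (Suc k) (Suc m)" and v: "v \<in> words t (Suc k) (Suc m)"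
        and uv: "head t u = head t v" for u v
      using u
    proof (cases rule: words_Suc_cases)
      case u': (1 a u')
      with uv have "\<exists>v'. v = a # v' \<and> v' \<in> words t (Suc k) m \<and> head t v' = head t u'"
        using v by (elim words_Suc_cases) auto
      then obtain v' where v': "v = a # v'" "v' \<in> words t (Suc k) m" "head t v' = head t u'" by blast
      show ?thesis unfolding u'(1) v'(1) letter by (rule w2c[OF _ u'(3) v'(2) v'(3)[symmetric]]) (simp add: u'(2))
    next
      case u': (2 u' k')
      with uv have "\<exists>v'. v = t # v' \<and> v' \<in> words (Suc t) k m"
        using v by (elim words_Suc_cases) auto
      then obtain v' where v': "v = t # v'" "v' \<in> words (Suc t) k m" by blast
      show ?thesis unfolding u'(1) v'(1) param
        by (rule w1c) (use wsubst_words[OF sw2] u' v' in auto)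
    qed
    then show "\<exists>w\<in>words t (Suc m) (Suc n). \<forall>u\<in>words t (Suc k) (Suc m). \<forall>v\<in>words t (Suc k) (Suc m).
        head t u = head t v \<longrightarrow> c (wsubst t u w) = c (wsubst t v w)"
      using words_Cons_param[OF w] by blast
  qed
  then show ?case ..
qed

text \<open>A leading letter \<open>a\<close> puts \<open>fill a l\<close> in front of the head, and
  the line \<open>l\<close> makes the choice of \<open>a\<close> irrelevant. A leading parameter
  ends the head inside the front block, whatever follows.\<close>

lemma gr_head_length:
  "\<exists>n. ramsey_family r (gr_family (head t) (\<lambda>u v. length (head t u) = length (head t v)) t (Suc k) m n)"
proof (induction m arbitrary: r)
  case 0
  have "ramsey_family r
      (gr_family (head t) (\<lambda>u v. length (head t u) = length (head t v)) t (Suc k) 0 0)"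
    by (rule gr_familyI) (simp add: words_0_iff)
  then show ?case ..
next
  case (Suc m)
  obtain h where h: "ramsey_family (r ^ card {..m}) (lines t h)" using hales_jewett by blast
  define Z where "Z = {y :: nat list. set y \<subseteq> {..<t} \<and> length y = h}"
  have finZ: "finite Z" unfolding Z_def by (rule finite_block)
  obtain n where n: "ramsey_family (r ^ card Z)
     (gr_family (head t) (\<lambda>u v. length (head t u) = length (head t v)) t (Suc k) m n)" using Suc by blast
  have "ramsey_family r
     (gr_family (head t) (\<lambda>u v. length (head t u) = length (head t v)) t (Suc k) (Suc m) (h + n))"
  proof (rule gr_familyI)
    fix c :: "nat list \<Rightarrow> nat" assume c: "\<And>x. c x < r"
    obtain w where w: "w \<in> words t m n"
      and wc: "\<And>y u v. y \<in> Z \<Longrightarrow> u \<in> words t (Suc k) m \<Longrightarrow> v \<in> words t (Suc k) m \<Longrightarrow>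
                 length (head t u) = length (head t v) \<Longrightarrow>
                 c (y @ head t (wsubst t u w)) = c (y @ head t (wsubst t v w))"
      using gr_familyD_simultaneous[OF n finZ, of "\<lambda>y x. c (y @ x)"] c by blast
    \<comment> \<open>By \<open>wc\<close> only the head length of the remaining word matters, so
      one representative for each length up to \<open>m\<close> suffices; hence the exponent
      \<open>card {..m}\<close>.\<close>
    define rep where "rep j = (SOME u. u \<in> words t (Suc k) m \<and> length (head t u) = j)" for j
    have rep: "rep (length (head t u)) \<in> words t (Suc k) m"
       "length (head t (rep (length (head t u)))) = length (head t u)"
      if "u \<in> words t (Suc k) m" for u
      using someI[of "\<lambda>v. v \<in> words t (Suc k) m \<and> length (head t v) = length (head t u)" u] that
      by (auto simp: rep_def)
    obtain l where l: "comb_line t h l"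
      and E: "\<And>j a b. j \<in> {..m} \<Longrightarrow> a < t \<Longrightarrow> b < t \<Longrightarrow>
         c (fill a l @ head t (wsubst t (rep j) w)) = c (fill b l @ head t (wsubst t (rep j) w))"
      using linesD_simultaneous[OF h finite_atMost, of "\<lambda>j x. c (x @ head t (wsubst t (rep j) w))"] c
      by blast
    have fZ: "fill a l \<in> Z" if "a < t" for a
      using fill_set[OF l that] l by (auto simp: Z_def comb_line_def)
    let ?w = "fill t l @ shift t w"
    have "?w \<in> words t (Suc m) (h + n)" by (rule words_line_append[OF l shift_words[OF w]])
    moreover have letter: "head t (wsubst t (a # u) ?w) = fill a l @ head t (wsubst t u w)"
      if "a < t" for a u
    proof -
      have "wsubst t (a # u) ?w = fill a l @ wsubst t u w"
        by (simp only: map_append wsubst_fill[OF l] wsubst_Cons_shift)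
      then show ?thesis using fZ[OF that] by (auto simp: Z_def takeWhile_append2 subset_iff)
    qed
    have "t \<in> set (fill t l)" using l by (force simp: comb_line_def fill_def)
    then have param: "head t (wsubst t (t # u) ?w) = head t (fill t l)" for u
      by (simp only: map_append wsubst_fill[OF l]) (rule takeWhile_append1, auto)
    have step: "c (head t (wsubst t u ?w)) = c (head t (wsubst t v ?w))"
      if u: "u \<in> words t (Suc k) (Suc m)" and v: "v \<in> words t (Suc k) (Suc m)"
        and uv: "length (head t u) = length (head t v)" for u v
      using u
    proof (cases rule: words_Suc_cases)
      case u': (1 a u')
      with uv have "\<exists>b v'. b < t \<and> v = b # v' \<and> v' \<in> words t (Suc k) m \<and>
          length (head t v') = length (head t u')"
        using v by (elim words_Suc_cases) auto
      then obtain b v' where v': "b < t" "v = b # v'" "v' \<in> words t (Suc k) m"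
        "length (head t v') = length (head t u')" by blast
      define u0 where "u0 = rep (length (head t u'))"
      have u0: "u0 \<in> words t (Suc k) m" "length (head t u0) = length (head t u')"
        using rep[OF u'(3)] by (auto simp: u0_def)
      have "length (head t u') \<le> m" using length_takeWhile_le words_length[OF u'(3)] by metis
      then have j: "length (head t u') \<in> {..m}" by simp
      have "c (fill a l @ head t (wsubst t u' w)) = c (fill a l @ head t (wsubst t u0 w))"
        by (rule wc[OF fZ[OF u'(2)] u'(3) u0(1) u0(2)[symmetric]])
      also have "\<dots> = c (fill b l @ head t (wsubst t u0 w))"
        unfolding u0_def by (rule E[OF j u'(2) v'(1)])
      also have "\<dots> = c (fill b l @ head t (wsubst t v' w))"
        by (rule wc[OF fZ[OF v'(1)] u0(1) v'(3)]) (simp add: u0 v')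
      finally show ?thesis unfolding u'(1) v'(2) letter[OF u'(2)] letter[OF v'(1)] .
    next
      case u': (2 u' k')
      with uv have "\<exists>v'. v = t # v'"
        using v by (elim words_Suc_cases) auto
      then obtain v' where v': "v = t # v'" by blast
      show ?thesis unfolding u'(1) v' param ..
    qed
    ultimately show "\<exists>w\<in>words t (Suc m) (h + n). \<forall>u\<in>words t (Suc k) (Suc m).
        \<forall>v\<in>words t (Suc k) (Suc m). length (head t u) = length (head t v) \<longrightarrow>
          c (head t (wsubst t u w)) = c (head t (wsubst t v w))"
      by blast
  qed
  then show ?case ..
qed

text \<open>The positions in \<open>J\<close> carry distinct parameters in increasing order, all
  others the letter \<open>0\<close>. Once a word containing a parameter is substituted, the head
  must stop at one of the positions in \<open>J\<close>.\<close>

lemma head_length_positions: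
  assumes "0 < t" "J \<subseteq> {..<M}" "card J = m"
  shows "\<exists>V\<in>words t m M. \<forall>u\<in>words t (Suc k) m. length (head t (wsubst t u V)) \<in> J"
  using assms(2,3)
proof (induction M arbitrary: J m)
  case 0
  then show ?case by (simp add: words_0_iff)
next
  case (Suc M)
  define J' where "J' = {j. Suc j \<in> J}"
  have J': "J' \<subseteq> {..<M}" using Suc.prems(1) by (auto simp: J'_def)
  then have finJ': "finite J'" using finite_subset by blast
  show ?case
  proof (cases "0 \<in> J")
    case True
    have "J = insert 0 (Suc ` J')"
      using True by (auto simp: J'_def image_iff) (metis not0_implies_Suc)
    then obtain m' where m: "m = Suc m'" and m': "card J' = m'"
      using Suc.prems(2) finJ' by (simp add: card_image)
    obtain V where V: "V \<in> words t m' M"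
      "\<And>u. u \<in> words t (Suc k) m' \<Longrightarrow> length (head t (wsubst t u V)) \<in> J'"
      using Suc.IH[OF J' m'] by auto
    have "t # shift t V \<in> words t m (Suc M)"
      using words_Cons_param[OF shift_words[OF V(1)]] m by simp
    moreover have "length (head t (wsubst t u (t # shift t V))) \<in> J" if "u \<in> words t (Suc k) m" for u
      using that unfolding m
    proof (cases rule: words_Suc_cases)
      case (1 a u')
      have "wsubst t (a # u') (t # shift t V) = a # wsubst t u' V"
        using wsubst_Cons_shift[of t a u' V] by (simp add: letter_subst_def[of t "a # u'" t])
      then show ?thesis using V(2)[OF 1(3)] 1 by (simp add: J'_def)
    next
      case (2 u' k')
      then show ?thesis using True by (simp add: letter_subst_def[of t _ t])
    qed
    ultimately show ?thesis by blast
  next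
    case False
    have "J = Suc ` J'" using False by (auto simp: J'_def image_iff) (metis not0_implies_Suc)
    then have "m = card J'" using Suc.prems(2) finJ' by (simp add: card_image)
    then obtain V where V: "V \<in> words t m M"
      "\<And>u. u \<in> words t (Suc k) m \<Longrightarrow> length (head t (wsubst t u V)) \<in> J'"
      using Suc.IH[OF J', of m] by auto
    have 0: "length (head t (wsubst t u (0 # V))) \<in> J" if "u \<in> words t (Suc k) m" for u
      using V(2)[OF that] assms(1) by (simp add: J'_def letter_subst_def[of t u 0])
    show ?thesis using 0 words_Cons_letter[OF assms(1) V(1)] by blast
  qed
qed

lemma pigeonhole_subset:
  assumes "\<And>x. c x < (r::nat)"
  obtains J i where "J \<subseteq> {..<r * m}" "card J = m" "\<And>j. j \<in> J \<Longrightarrow> c j = i"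
proof -
  have "\<exists>i<r. m \<le> card {j. j < r * m \<and> c j = i}"
  proof (rule ccontr)
    assume no: "\<not> ?thesis"
    have "{..<r * m} = (\<Union>i<r. {j. j < r * m \<and> c j = i})" using assms by auto
    then have "r * m = card (\<Union>i<r. {j. j < r * m \<and> c j = i})" by (metis card_lessThan)
    also have "\<dots> \<le> (\<Sum>i<r. card {j. j < r * m \<and> c j = i})" by (rule card_UN_le) simp
    also have "\<dots> < (\<Sum>i<r. m)"
      \<comment> \<open>The bound at an arbitrary argument shows that \<open>r\<close> is positive,
        so the sum is over a nonempty set and the inequality is strict.\<close>
      using no assms[of undefined] by (intro sum_strict_mono) auto
    finally show False by simp
  qed
  then obtain i where "m \<le> card {j. j < r * m \<and> c j = i}" by blast
  then obtain J where J: "J \<subseteq> {j. j < r * m \<and> c j = i}" "card J = m"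
    by (rule obtain_subset_with_card_n)
  show ?thesis by (rule that[of J i]) (use J in auto)
qed

text \<open>For \<open>0 < t\<close> three reductions are nested: \<open>w1\<close> leaves a
  colouring of heads, \<open>w2\<close> a colouring of head lengths, and \<open>V\<close> confines
  the lengths to \<open>m\<close> values of equal colour found among \<open>r * m\<close>.\<close>

theorem graham_rothschild_words: "\<exists>n. ramsey_family r (full_gr_family t k m n)"
proof (induction k arbitrary: t m r)
  case 0
  show ?case by (rule gr_zero)
next
  case (Suc k)
  consider "t = 0" "m = 0" | m' where "t = 0" "m = Suc m'" | "0 < t" by (cases m) auto
  then show ?case
  proof cases
    case 1
    have "ramsey_family r (full_gr_family t (Suc k) m 0)"
      unfolding 1 by (rule gr_familyI) (simp add: words_0_iff)
    then show ?thesis ..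
  next
    \<comment> \<open>Over the empty alphabet every nonempty word starts with its first parameter,
      which then acts as a letter for the remaining \<open>k\<close> parameters.\<close>
    case 2
    obtain n where n: "ramsey_family r (full_gr_family (Suc t) k m' n)" using Suc by blast
    have "ramsey_family r (full_gr_family t (Suc k) m (Suc n))"
    proof (rule gr_familyI)
      fix c :: "nat list \<Rightarrow> nat" assume c: "\<And>x. c x < r"
      obtain w where w: "w \<in> words (Suc t) m' n"
        and wc: "\<And>u v. u \<in> words (Suc t) k m' \<Longrightarrow> v \<in> words (Suc t) k m' \<Longrightarrow>
                   c (t # wsubst (Suc t) u w) = c (t # wsubst (Suc t) v w)"
        using full_gr_familyD[OF n, of "\<lambda>x. c (t # x)"] c by blast
      have eq: "\<exists>u'\<in>words (Suc t) k m'. wsubst t u (t # w) = t # wsubst (Suc t) u' w"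
        if "u \<in> words t (Suc k) m" for u
        using that unfolding 2(2)
      proof (cases rule: words_Suc_cases)
        case (2 u' k')
        then show ?thesis
          by (intro bexI[of _ u']) (simp_all add: letter_subst_Cons_param letter_subst_def[of _ _ t])
      qed (use 2 in auto)
      have "c (wsubst t u (t # w)) = c (wsubst t v (t # w))"
        if "u \<in> words t (Suc k) m" "v \<in> words t (Suc k) m" for u v
        using eq[OF that(1)] eq[OF that(2)] wc by metis
      then show "\<exists>w\<in>words t m (Suc n). \<forall>u\<in>words t (Suc k) m. \<forall>v\<in>words t (Suc k) m. True \<longrightarrow>
         c (wsubst t u w) = c (wsubst t v w)"
        using words_Cons_param[OF w] 2 by blast
    qed
    then show ?thesis ..
  next
    case t: 3
    obtain m1 where m1: "ramsey_family r
       (gr_family (head t) (\<lambda>u v. length (head t u) = length (head t v)) t (Suc k) (r * m) m1)"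
      using gr_head_length by blast
    obtain n where n: "ramsey_family r
       (gr_family (\<lambda>w. w) (\<lambda>u v. head t u = head t v) t (Suc k) m1 n)"
      using gr_constant_after_head[of t k] Suc by blast
    have "ramsey_family r (full_gr_family t (Suc k) m n)"
    proof (rule gr_familyI)
      fix c :: "nat list \<Rightarrow> nat" assume c: "\<And>x. c x < r"
      obtain w1 where w1: "w1 \<in> words t m1 n"
        and w1c: "\<And>u v. u \<in> words t (Suc k) m1 \<Longrightarrow> v \<in> words t (Suc k) m1 \<Longrightarrow>
           head t u = head t v \<Longrightarrow> c (wsubst t u w1) = c (wsubst t v w1)"
        using gr_familyD[OF n, of c] c by blast
      \<comment> \<open>Choosing a word with the given head turns the colouring of words into one of
        heads; heads that do not occur get some colour, still below \<open>r\<close>.\<close>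
      define c1 where "c1 p = c (wsubst t (SOME u. u \<in> words t (Suc k) m1 \<and> head t u = p) w1)" for p
      have c1: "c (wsubst t u w1) = c1 (head t u)" if "u \<in> words t (Suc k) m1" for u
        using someI[of "\<lambda>v. v \<in> words t (Suc k) m1 \<and> head t v = head t u" u] that w1c[OF that]
        unfolding c1_def by metis
      obtain w2 where w2: "w2 \<in> words t (r * m) m1"
        and w2c: "\<And>u v. u \<in> words t (Suc k) (r * m) \<Longrightarrow> v \<in> words t (Suc k) (r * m) \<Longrightarrow>
           length (head t u) = length (head t v) \<Longrightarrow>
           c1 (head t (wsubst t u w2)) = c1 (head t (wsubst t v w2))"
        using gr_familyD[OF m1, of c1] c unfolding c1_def by blast
      define c2 where "c2 j = c1 (head t (wsubst t
          (SOME u. u \<in> words t (Suc k) (r * m) \<and> length (head t u) = j) w2))" for j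
      have c2: "c1 (head t (wsubst t u w2)) = c2 (length (head t u))"
        if "u \<in> words t (Suc k) (r * m)" for u
      proof -
        define v where "v = (SOME v. v \<in> words t (Suc k) (r * m) \<and> length (head t v) = length (head t u))"
        have "v \<in> words t (Suc k) (r * m) \<and> length (head t v) = length (head t u)"
          unfolding v_def by (rule someI[of _ u]) (simp add: that)
        then show ?thesis unfolding c2_def v_def[symmetric] using w2c[OF that] by simp
      qed
      have "c2 j < r" for j unfolding c2_def c1_def by (rule c)
      then obtain J i where J: "J \<subseteq> {..<r * m}" "card J = m" "\<And>j. j \<in> J \<Longrightarrow> c2 j = i"
        by (rule pigeonhole_subset[where m = m and c = c2]) blast
      obtain V where V: "V \<in> words t m (r * m)"
        "\<And>u. u \<in> words t (Suc k) m \<Longrightarrow> length (head t (wsubst t u V)) \<in> J"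
        using head_length_positions[OF t J(1,2), of k] by blast
      define w where "w = wsubst t (wsubst t V w2) w1"
      have w: "w \<in> words t m n" unfolding w_def by (intro wsubst_words[OF w1] wsubst_words[OF w2] V(1))
      have "c (wsubst t u w) = i" if u: "u \<in> words t (Suc k) m" for u
      proof -
        have uV: "wsubst t u V \<in> words t (Suc k) (r * m)" by (rule wsubst_words[OF V(1) u])
        have "wsubst t u w = wsubst t (wsubst t (wsubst t u V) w2) w1"
          unfolding w_def wsubst_assoc[OF w1 wsubst_words[OF w2 V(1)]] wsubst_assoc[OF w2 V(1)] ..
        then have "c (wsubst t u w) = c1 (head t (wsubst t (wsubst t u V) w2))"
          using c1[OF wsubst_words[OF w2 uV]] by metis
        also have "\<dots> = i" unfolding c2[OF uV] by (rule J(3)[OF V(2)[OF u]])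
        finally show ?thesis .
      qed
      then show "\<exists>w\<in>words t m n. \<forall>u\<in>words t (Suc k) m. \<forall>v\<in>words t (Suc k) m. True \<longrightarrow>
          c (wsubst t u w) = c (wsubst t v w)" using w by metis
    qed
    then show ?thesis ..
  qed
qed

section \<open>Rigid surjections as parameter words\<close>

text \<open>The form without recursion, in which every symbol is preceded by all smaller parameters,
  can be compared with the definition of \<open>Epi\<close>.\<close>

lemma param_word_iff:
  "param_word t k w \<longleftrightarrow> {t..<t + k} \<subseteq> set w \<and> set w \<subseteq> {..<t + k} \<and>
     (\<forall>i<length w. \<forall>s. t \<le> s \<longrightarrow> s < w ! i \<longrightarrow> s \<in> set (take i w))"
proof (induction w arbitrary: t k)
  case Nil
  then show ?case by auto
next
  case (Cons x w)
  have split: "(\<forall>i<length (x # w). \<forall>s. t \<le> s \<longrightarrow> s < (x # w) ! i \<longrightarrow> s \<in> set (take i (x # w))) \<longleftrightarrow>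
      x \<le> t \<and> (\<forall>i<length w. \<forall>s. t \<le> s \<longrightarrow> s < w ! i \<longrightarrow> s = x \<or> s \<in> set (take i w))"
  proof -
    have "(\<forall>s. t \<le> s \<longrightarrow> s < x \<longrightarrow> False) \<longleftrightarrow> x \<le> t"
      by (metis leD leI order_less_le_trans order_refl)
    then show ?thesis by (simp add: All_less_Suc2)
  qed
  consider "x < t" | "x = t" "k = 0" | k' where "x = t" "k = Suc k'" | "t < x"
    by (cases k; cases x t rule: linorder_cases) auto
  then show ?case
  proof cases
    case 1
    then have x: "s = x \<or> s \<in> A \<longleftrightarrow> s \<in> A" if "t \<le> s" for s A using that by auto
    have "(\<forall>i<length w. \<forall>s. t \<le> s \<longrightarrow> s < w ! i \<longrightarrow> s = x \<or> s \<in> set (take i w)) \<longleftrightarrow>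
      (\<forall>i<length w. \<forall>s. t \<le> s \<longrightarrow> s < w ! i \<longrightarrow> s \<in> set (take i w))"
      using x by blast
    moreover have "{t..<t + k} \<subseteq> set (x # w) \<longleftrightarrow> {t..<t + k} \<subseteq> set w" using 1 by auto
    ultimately show ?thesis unfolding split using 1 Cons[of t k] by simp
  next
    case 2
    then show ?thesis unfolding split by simp
  next
    case 3
    have x: "(t \<le> s \<longrightarrow> P \<longrightarrow> s = x \<or> Q) \<longleftrightarrow> (Suc t \<le> s \<longrightarrow> P \<longrightarrow> Q)" for s P Q
      using 3(1) by auto
    have "{t..<t + k} \<subseteq> set (x # w) \<longleftrightarrow> {Suc t..<Suc t + k'} \<subseteq> set w"
    proof -
      have "{t..<t + k} = insert x {Suc t..<Suc t + k'}" using 3 by auto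
      then show ?thesis using 3 by (auto simp: subset_insert_iff)
    qed
    moreover have "set (x # w) \<subseteq> {..<t + k} \<longleftrightarrow> set w \<subseteq> {..<Suc t + k'}" using 3 by auto
    ultimately show ?thesis unfolding split x using 3 Cons[of "Suc t" k'] by simp
  next
    case 4
    then show ?thesis unfolding split by simp
  qed
qed

text \<open>For a surjection, increasing minima of the fibres mean that each value is preceded by
  all smaller ones, which is \<open>param_word_iff\<close> for \<open>t = 0\<close>.\<close>

lemma Epi_iff_words:
  "f \<in> Epi n a \<longleftrightarrow> map f [0..<n] \<in> words 0 a n \<and> (\<forall>j\<ge>n. f j = 0)"
proof -
  let ?F = "\<lambda>s. {j. j < n \<and> f j = s}"
  have order: "(\<forall>s0 s1. s0 < s1 \<and> s1 < a \<longrightarrow> Min (?F s0) < Min (?F s1)) \<longleftrightarrow>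
     (\<forall>i<n. \<forall>s<f i. s \<in> f ` {..<i})" if surj: "f ` {..<n} = {..<a}"
  proof (intro iffI allI impI)
    fix i s assume *: "\<forall>s0 s1. s0 < s1 \<and> s1 < a \<longrightarrow> Min (?F s0) < Min (?F s1)" and i: "i < n" "s < f i"
    have a: "f i < a" using surj i(1) by auto
    then have "s \<in> f ` {..<n}" using surj i by auto
    then have "Min (?F s) \<in> ?F s" by (intro Min_in) auto
    moreover have "Min (?F s) < Min (?F (f i))" using * i a by blast
    moreover have "Min (?F (f i)) \<le> i" using i by (intro Min_le) auto
    ultimately show "s \<in> f ` {..<i}" by (intro image_eqI[of _ _ "Min (?F s)"]) auto
  next
    fix s0 s1 assume *: "\<forall>i<n. \<forall>s<f i. s \<in> f ` {..<i}" and s: "s0 < s1 \<and> s1 < a"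
    then have "s1 \<in> f ` {..<n}" using surj by auto
    then have m: "Min (?F s1) \<in> ?F s1" by (intro Min_in) auto
    then have "s0 \<in> f ` {..<Min (?F s1)}" using * s by simp
    then obtain j where "j < Min (?F s1)" "f j = s0" by blast
    moreover from this have "Min (?F s0) \<le> j" using m by (intro Min_le) auto
    ultimately show "Min (?F s0) < Min (?F s1)" by simp
  qed
  have "set (map f [0..<n]) = f ` {..<n}" by (simp add: atLeast0LessThan)
  moreover have "set (take i (map f [0..<n])) = f ` {..<i}" if "i < n" for i
    using that by (simp add: take_map atLeast0LessThan)
  ultimately have "map f [0..<n] \<in> words 0 a n \<longleftrightarrow>
      f ` {..<n} = {..<a} \<and> (\<forall>i<n. \<forall>s<f i. s \<in> f ` {..<i})"
    unfolding words_def param_word_iff by (simp add: set_eq_subset atLeast0LessThan) blast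
  moreover have "f \<in> Epi n a \<longleftrightarrow> f ` {..<n} = {..<a} \<and> (\<forall>j\<ge>n. f j = 0) \<and>
      (\<forall>s0 s1. s0 < s1 \<and> s1 < a \<longrightarrow> Min (?F s0) < Min (?F s1))"
    unfolding Epi_def by simp
  ultimately show ?thesis using order by satx
qed

lemma map_epi_comp:
  assumes "\<gamma> \<in> Epi n b"
  shows "map (epi_comp n f \<gamma>) [0..<n] = wsubst 0 (map f [0..<b]) (map \<gamma> [0..<n])"
proof -
  have "\<gamma> j < b" if "j < n" for j using assms that by (auto simp: Epi_def)
  then show ?thesis by (auto simp: epi_comp_def letter_subst_def)
qed

theorem graham_rothschild:
  assumes "0 < r"
  shows "\<exists>n. gr_prop a b r n"
proof -
  obtain n where n: "ramsey_family r (full_gr_family 0 a b n)" using graham_rothschild_words by blast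
  have of_word: "(\<lambda>j. if j < l then w ! j else 0) \<in> Epi l k"
    "map (\<lambda>j. if j < l then w ! j else 0) [0..<l] = w" if "w \<in> words 0 k l" for w k l
  proof -
    show eq: "map (\<lambda>j. if j < l then w ! j else 0) [0..<l] = w"
      using words_length[OF that] by (auto intro: nth_equalityI)
    then show "(\<lambda>j. if j < l then w ! j else 0) \<in> Epi l k" using that by (simp add: Epi_iff_words)
  qed
  have "gr_prop a b r n"
    unfolding gr_prop_def
  proof (intro allI impI)
    fix c :: "(nat \<Rightarrow> nat) \<Rightarrow> nat" assume c: "\<forall>g\<in>Epi n a. c g < r"
    have "\<exists>\<gamma>\<in>Epi n b. \<forall>f\<in>Epi b a. \<forall>g\<in>Epi b a. c (epi_comp n f \<gamma>) = c (epi_comp n g \<gamma>)"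
    proof -
      \<comment> \<open>Lists that are not words get the colour \<open>0\<close>, which is
        admissible because \<open>r\<close> is positive.\<close>
      define c' where "c' w = (if w \<in> words 0 a n then c (\<lambda>j. if j < n then w ! j else 0) else 0)" for w
      have c': "c' w < r" for w using c of_word(1)[of w a n] assms by (simp add: c'_def)
      obtain w where w: "w \<in> words 0 b n" "\<And>u v. u \<in> words 0 a b \<Longrightarrow> v \<in> words 0 a b \<Longrightarrow>
          c' (wsubst 0 u w) = c' (wsubst 0 v w)"
        using full_gr_familyD[OF n, of c'] c' by blast
      define \<gamma> where "\<gamma> = (\<lambda>j. if j < n then w ! j else 0)"
      have \<gamma>: "\<gamma> \<in> Epi n b" "map \<gamma> [0..<n] = w" unfolding \<gamma>_def using of_word[OF w(1)] by blast+
      have "c (epi_comp n f \<gamma>) = c' (wsubst 0 (map f [0..<b]) w)" if "f \<in> Epi b a" for f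
      proof -
        have "wsubst 0 (map f [0..<b]) w \<in> words 0 a n"
          using wsubst_words[OF w(1)] that by (simp add: Epi_iff_words)
        moreover have "epi_comp n f \<gamma> = (\<lambda>j. if j < n then wsubst 0 (map f [0..<b]) w ! j else 0)"
        proof
          fix j show "epi_comp n f \<gamma> j = (if j < n then wsubst 0 (map f [0..<b]) w ! j else 0)"
            unfolding \<gamma>(2)[symmetric] map_epi_comp[OF \<gamma>(1), symmetric] by (simp add: epi_comp_def)
        qed
        ultimately show ?thesis by (simp add: c'_def)
      qed
      then have "c (epi_comp n f \<gamma>) = c (epi_comp n g \<gamma>)" if "f \<in> Epi b a" "g \<in> Epi b a" for f g
        using w(2) that Epi_iff_words[of _ b a] by metis
      then show ?thesis using \<gamma>(1) by blast
    qed
    then show "\<exists>\<gamma>\<in>Epi n b. \<exists>i. \<forall>f\<in>Epi b a. c (epi_comp n f \<gamma>) = i" by metis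
  qed
  then show ?thesis ..
qed

subsection \<open>Separated sets in the unit ball of the sum norm\<close>

text \<open>Lebesgue measure in dimension \<open>d\<close>, as a product over an index set so that
  \<open>d\<close> can be a variable and not a type.\<close>

abbreviation lbox :: "nat \<Rightarrow> (nat \<Rightarrow> real) measure" where
  "lbox d \<equiv> PiM {..<d} (\<lambda>_. lborel)"

definition l1norm :: "nat \<Rightarrow> (nat \<Rightarrow> real) \<Rightarrow> real" where
  "l1norm d x = (\<Sum>j<d. \<bar>x j\<bar>)"

text \<open>The points are extensional functions, as the product measure requires; the centre
  \<open>c\<close> may be any function.\<close>

definition l1ball :: "nat \<Rightarrow> (nat \<Rightarrow> real) \<Rightarrow> real \<Rightarrow> (nat \<Rightarrow> real) set" where
  "l1ball d c r = {x \<in> space (lbox d). l1norm d (\<lambda>j. x j - c j) < r}"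

lemma l1norm_nonneg [simp]: "0 \<le> l1norm d x"
  by (simp add: l1norm_def sum_nonneg)

lemma l1norm_triangle: "l1norm d (\<lambda>j. x j + y j) \<le> l1norm d x + l1norm d y"
  unfolding l1norm_def sum.distrib[symmetric] by (intro sum_mono) simp

lemma l1norm_triangle_diff: "l1norm d (\<lambda>j. x j - z j) \<le> l1norm d (\<lambda>j. x j - y j) + l1norm d (\<lambda>j. y j - z j)"
  using l1norm_triangle[of d "\<lambda>j. x j - y j" "\<lambda>j. y j - z j"] by simp

lemma l1norm_minus_commute: "l1norm d (\<lambda>j. x j - y j) = l1norm d (\<lambda>j. y j - x j)"
  by (simp add: l1norm_def abs_minus_commute)

lemma l1norm_scale: "l1norm d (\<lambda>j. a * x j) = \<bar>a\<bar> * l1norm d x"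
  by (simp add: l1norm_def abs_mult sum_distrib_left)

lemma l1norm_cong: "(\<And>j. j < d \<Longrightarrow> x j = y j) \<Longrightarrow> l1norm d x = l1norm d y"
  by (simp add: l1norm_def)

interpretation lbox: product_sigma_finite "\<lambda>_::nat. lborel :: real measure"
  by standard

lemma l1ball_sets [measurable]: "l1ball d c r \<in> sets (lbox d)"
  unfolding l1ball_def l1norm_def by measurable

text \<open>A product measure is determined by its values on boxes, where the claim splits into the
  one-dimensional change of variables.\<close>

lemma lbox_affine:
  assumes r: "0 < r"
  shows "lbox d = density (distr (lbox d) (lbox d) (\<lambda>x. \<lambda>j\<in>{..<d}. c j + r * x j)) (\<lambda>_. ennreal (r ^ d))"
    (is "_ = ?P")
proof (rule lbox.PiM_eqI[symmetric])
  show "finite {..<d}" by simp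
  show "sets ?P = sets (lbox d)" by simp
  fix A :: "nat \<Rightarrow> real set" assume A: "\<And>i. i \<in> {..<d} \<Longrightarrow> A i \<in> sets lborel"
  have one: "ennreal r * emeasure lborel ((\<lambda>x. c i + r * x) -` A i) = emeasure lborel (A i)"
    if "i \<in> {..<d}" for i
  proof -
    have "emeasure lborel (A i) =
        emeasure (density (distr lborel borel (\<lambda>x. c i + r * x)) (\<lambda>_. ennreal \<bar>r\<bar>)) (A i)"
      using lborel_real_affine[of r "c i"] r by simp
    then show ?thesis using A[OF that] r
      by (simp add: emeasure_density_const emeasure_distr)
  qed
  have "emeasure ?P (PiE {..<d} A) =
      ennreal (r ^ d) * emeasure (distr (lbox d) (lbox d) (\<lambda>x. \<lambda>j\<in>{..<d}. c j + r * x j)) (PiE {..<d} A)"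
    using A by (intro emeasure_density_const) (auto intro!: sets_PiM_I_finite)
  also have "emeasure (distr (lbox d) (lbox d) (\<lambda>x. \<lambda>j\<in>{..<d}. c j + r * x j)) (PiE {..<d} A) =
      emeasure (lbox d) (PiE {..<d} (\<lambda>i. (\<lambda>x. c i + r * x) -` A i))"
  proof (subst emeasure_distr)
    show "(\<lambda>x. \<lambda>j\<in>{..<d}. c j + r * x j) \<in> lbox d \<rightarrow>\<^sub>M lbox d" by measurable
    show "PiE {..<d} A \<in> sets (lbox d)" using A by (auto intro!: sets_PiM_I_finite)
    show "emeasure (lbox d) ((\<lambda>x. \<lambda>j\<in>{..<d}. c j + r * x j) -` PiE {..<d} A \<inter> space (lbox d)) =
      emeasure (lbox d) (PiE {..<d} (\<lambda>i. (\<lambda>x. c i + r * x) -` A i))"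
      by (rule arg_cong[of _ _ "emeasure (lbox d)"]) (auto simp: space_PiM PiE_iff)
  qed
  also have "\<dots> = (\<Prod>i<d. emeasure lborel ((\<lambda>x. c i + r * x) -` A i))"
  proof (rule lbox.emeasure_PiM)
    fix i assume "i \<in> {..<d}"
    then have "A i \<in> sets borel" using A by simp
    then show "(\<lambda>x. c i + r * x) -` A i \<in> sets lborel"
      using measurable_sets[of "\<lambda>x. c i + r * x" borel borel "A i"] by simp
  qed simp
  also have "ennreal (r ^ d) * \<dots> = (\<Prod>i<d. ennreal r * emeasure lborel ((\<lambda>x. c i + r * x) -` A i))"
    using r by (simp add: prod.distrib ennreal_power)
  also have "\<dots> = (\<Prod>i<d. emeasure lborel (A i))" using one by simp
  finally show "emeasure ?P (PiE {..<d} A) = (\<Prod>i<d. emeasure lborel (A i))" .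
qed

lemma emeasure_l1ball:
  assumes r: "0 < r"
  shows "emeasure (lbox d) (l1ball d c r) = ennreal (r ^ d) * emeasure (lbox d) (l1ball d (\<lambda>_. 0) 1)"
proof -
  have "emeasure (lbox d) (l1ball d c r) =
      ennreal (r ^ d) * emeasure (distr (lbox d) (lbox d) (\<lambda>x. \<lambda>j\<in>{..<d}. c j + r * x j)) (l1ball d c r)"
    by (subst lbox_affine[OF r, of d c], rule emeasure_density_const) simp
  also have "emeasure (distr (lbox d) (lbox d) (\<lambda>x. \<lambda>j\<in>{..<d}. c j + r * x j)) (l1ball d c r) =
      emeasure (lbox d) (l1ball d (\<lambda>_. 0) 1)"
  proof (subst emeasure_distr)
    have "l1norm d (\<lambda>j. (\<lambda>j\<in>{..<d}. c j + r * x j) j - c j) = r * l1norm d x" for x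
      using r l1norm_scale[of d r x] by (simp add: l1norm_def)
    then show "emeasure (lbox d) ((\<lambda>x. \<lambda>j\<in>{..<d}. c j + r * x j) -` l1ball d c r \<inter> space (lbox d)) =
      emeasure (lbox d) (l1ball d (\<lambda>_. 0) 1)"
      using r
      by (intro arg_cong[of _ _ "emeasure (lbox d)"]) (auto simp: l1ball_def space_PiM)
  qed measurable
  finally show ?thesis .
qed

text \<open>The unit ball lies between two boxes. A finite, nonzero volume can be cancelled when
  volumes of balls are compared.\<close>

lemma emeasure_l1ball_unit:
  "emeasure (lbox d) (l1ball d (\<lambda>_. 0) 1) \<noteq> \<infinity>" "emeasure (lbox d) (l1ball d (\<lambda>_. 0) 1) \<noteq> 0"
proof -
  have "l1ball d (\<lambda>_. 0) 1 \<subseteq> PiE {..<d} (\<lambda>_. {-1..1})"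
  proof
    fix x assume x: "x \<in> l1ball d (\<lambda>_. 0) 1"
    have "\<bar>x j\<bar> \<le> 1" if "j < d" for j
      using member_le_sum[of j "{..<d}" "\<lambda>j. \<bar>x j\<bar>"] x that by (auto simp: l1ball_def l1norm_def)
    then show "x \<in> PiE {..<d} (\<lambda>_. {-1..1})"
      using x by (auto simp: l1ball_def space_PiM PiE_iff abs_le_iff)
  qed
  then have "emeasure (lbox d) (l1ball d (\<lambda>_. 0) 1) \<le> emeasure (lbox d) (PiE {..<d} (\<lambda>_. {-1..1}))"
    by (intro emeasure_mono) (auto intro!: sets_PiM_I_finite)
  also have "\<dots> = 2 ^ d" by (subst lbox.emeasure_PiM) auto
  also have "\<dots> < \<infinity>" by (simp add: power_less_top_ennreal)
  finally show "emeasure (lbox d) (l1ball d (\<lambda>_. 0) 1) \<noteq> \<infinity>" by simp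
  \<comment> \<open>The denominator \<open>d + 1\<close> keeps \<open>d * s\<close> strictly below
    \<open>1\<close>, also for \<open>d = 0\<close>.\<close>
  define s where "s = 1 / (real d + 1)"
  have s: "0 < s" by (simp add: s_def)
  have "PiE {..<d} (\<lambda>_. {0..s}) \<subseteq> l1ball d (\<lambda>_. 0) 1"
  proof
    fix x assume x: "x \<in> PiE {..<d} (\<lambda>_. {0..s})"
    have "l1norm d x \<le> (\<Sum>j<d. s)" unfolding l1norm_def
      using x by (intro sum_mono) (auto simp: PiE_iff)
    also have "\<dots> < 1" by (simp add: s_def)
    finally show "x \<in> l1ball d (\<lambda>_. 0) 1" using x by (auto simp: l1ball_def space_PiM)
  qed
  then have "emeasure (lbox d) (PiE {..<d} (\<lambda>_. {0..s})) \<le> emeasure (lbox d) (l1ball d (\<lambda>_. 0) 1)"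
    by (intro emeasure_mono) auto
  moreover have "emeasure (lbox d) (PiE {..<d} (\<lambda>_. {0..s})) = ennreal s ^ d"
    using s by (subst lbox.emeasure_PiM) auto
  moreover have "ennreal s ^ d \<noteq> 0" using s by (simp add: ennreal_power)
  ultimately show "emeasure (lbox d) (l1ball d (\<lambda>_. 0) 1) \<noteq> 0" by auto
qed

text \<open>The balls of radius \<open>\<delta> / 2\<close> around the points are disjoint and lie
  in the ball of radius \<open>1 + \<delta> / 2\<close> around the origin.\<close>

lemma card_separated_le:
  assumes fin: "finite T" and \<delta>: "0 < \<delta>"
    and ball: "\<And>x. x \<in> T \<Longrightarrow> l1norm d x \<le> 1"
    and sep: "\<And>x y. x \<in> T \<Longrightarrow> y \<in> T \<Longrightarrow> x \<noteq> y \<Longrightarrow> \<delta> \<le> l1norm d (\<lambda>j. x j - y j)"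
  shows "real (card T) \<le> (1 + 2 / \<delta>) ^ d"
proof -
  define V where "V = measure (lbox d) (l1ball d (\<lambda>_. 0) 1)"
  have V: "emeasure (lbox d) (l1ball d (\<lambda>_. 0) 1) = ennreal V"
    using emeasure_l1ball_unit(1) by (simp add: V_def emeasure_eq_ennreal_measure)
  have V0: "0 < V" using emeasure_l1ball_unit(2)[of d] V by (simp add: V_def zero_less_measure_iff)
  have "disjoint_family_on (\<lambda>x. l1ball d x (\<delta> / 2)) T"
    unfolding disjoint_family_on_def
  proof (intro ballI impI equals0I)
    fix x y z assume xy: "x \<in> T" "y \<in> T" "x \<noteq> y" and z: "z \<in> l1ball d x (\<delta> / 2) \<inter> l1ball d y (\<delta> / 2)"
    have "\<delta> \<le> l1norm d (\<lambda>j. x j - y j)" using sep xy by blast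
    also have "\<dots> \<le> l1norm d (\<lambda>j. x j - z j) + l1norm d (\<lambda>j. z j - y j)" by (rule l1norm_triangle_diff)
    also have "\<dots> < \<delta>" using z l1norm_minus_commute[of d x z] by (auto simp: l1ball_def)
    finally show False by simp
  qed
  then have "(\<Sum>x\<in>T. emeasure (lbox d) (l1ball d x (\<delta> / 2))) =
      emeasure (lbox d) (\<Union>x\<in>T. l1ball d x (\<delta> / 2))"
    using fin by (intro sum_emeasure) auto
  also have "\<dots> \<le> emeasure (lbox d) (l1ball d (\<lambda>_. 0) (1 + \<delta> / 2))"
  proof (rule emeasure_mono)
    show "(\<Union>x\<in>T. l1ball d x (\<delta> / 2)) \<subseteq> l1ball d (\<lambda>_. 0) (1 + \<delta> / 2)"
    proof
      fix z assume "z \<in> (\<Union>x\<in>T. l1ball d x (\<delta> / 2))"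
      then obtain x where "x \<in> T" "z \<in> l1ball d x (\<delta> / 2)" by blast
      then show "z \<in> l1ball d (\<lambda>_. 0) (1 + \<delta> / 2)"
        using ball[of x] l1norm_triangle[of d "\<lambda>j. z j - x j" x] by (auto simp: l1ball_def)
    qed
  qed simp
  finally have "ennreal (real (card T)) * (ennreal ((\<delta> / 2) ^ d) * ennreal V) \<le> ennreal ((1 + \<delta> / 2) ^ d) * ennreal V"
    using \<delta> by (simp add: emeasure_l1ball V ennreal_of_nat_eq_real_of_nat)
  then have "real (card T) * ((\<delta> / 2) ^ d * V) \<le> (1 + \<delta> / 2) ^ d * V"
    using \<delta> V0 by (simp flip: ennreal_mult')
  then have "real (card T) \<le> (1 + \<delta> / 2) ^ d / (\<delta> / 2) ^ d"
    using \<delta> V0 by (simp add: pos_le_divide_eq)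
  also have "\<dots> = (1 + 2 / \<delta>) ^ d" using \<delta> by (simp add: add_divide_distrib add.commute flip: power_divide)
  finally show ?thesis .
qed

section \<open>Nets in the unit ball of the sum norm\<close>

text \<open>Cardinalities of separated sets are bounded by the volume count, and one of greatest
  cardinality is a net, since a far point could be added. The zero vector and the unit vectors are
  separated because \<open>\<delta> \<le> 1\<close>, so the search can start from them.\<close>

lemma l1_net_maximal:
  fixes \<delta> :: real
  assumes \<delta>: "0 < \<delta>" "\<delta> \<le> 1"
  obtains T where "finite T" "real (card T) \<le> (1 + 2 / \<delta>) ^ d" "\<And>x. x \<in> T \<Longrightarrow> l1norm d x \<le> 1"
    "(\<lambda>_. 0) \<in> T" "\<And>i. i < d \<Longrightarrow> (\<lambda>j. if j = i then 1 else 0) \<in> T"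
    "\<And>v. l1norm d v \<le> 1 \<Longrightarrow> \<exists>p\<in>T. l1norm d (\<lambda>j. v j - p j) < \<delta>"
proof -
  define T0 where "T0 = insert (\<lambda>_. 0) ((\<lambda>i j. if j = i then 1 else (0::real)) ` {..<d})"
  define P where "P T \<longleftrightarrow> T0 \<subseteq> T \<and> finite T \<and> (\<forall>x\<in>T. l1norm d x \<le> 1) \<and>
      (\<forall>x\<in>T. \<forall>y\<in>T. x \<noteq> y \<longrightarrow> \<delta> \<le> l1norm d (\<lambda>j. x j - y j))" for T
  have coord: "1 \<le> l1norm d x" if "i < d" "\<bar>x i\<bar> = 1" for i x
    using member_le_sum[of i "{..<d}" "\<lambda>j. \<bar>x j\<bar>"] that by (simp add: l1norm_def)
  have zero: "l1norm d (\<lambda>_. 0) = 0" by (simp add: l1norm_def)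
  have unit: "l1norm d (\<lambda>j. if j = i then 1 else 0) \<le> 1" for i
    by (simp add: l1norm_def if_distrib[of abs] cong: if_cong)
  have "\<delta> \<le> l1norm d (\<lambda>j. x j - y j)" if "x \<in> T0" "y \<in> T0" "x \<noteq> y" for x y
  proof -
    have "\<exists>i<d. \<bar>x i - y i\<bar> = 1"
      using that unfolding T0_def by (elim insertE imageE) auto
    then show ?thesis using coord[of _ "\<lambda>j. x j - y j"] \<delta>(2) by force
  qed
  then have "P T0" using zero unit unfolding P_def by (auto simp: T0_def)
  have bound: "real (card T) \<le> (1 + 2 / \<delta>) ^ d" if "P T" for T
    using that unfolding P_def by (intro card_separated_le \<delta>(1)) auto
  then have "\<forall>T. P T \<longrightarrow> card T < Suc (nat \<lfloor>(1 + 2 / \<delta>) ^ d\<rfloor>)"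
    by (simp add: le_nat_floor less_Suc_eq_le)
  then obtain T where T: "P T" "\<And>S. P S \<Longrightarrow> card S \<le> card T"
    using ex_has_greatest_nat[of P T0 card] \<open>P T0\<close> by blast
  have "\<exists>p\<in>T. l1norm d (\<lambda>j. v j - p j) < \<delta>" if v: "l1norm d v \<le> 1" for v
  proof (rule ccontr)
    assume "\<not> ?thesis"
    then have far: "\<delta> \<le> l1norm d (\<lambda>j. v j - p j)" if "p \<in> T" for p using that by force
    then have "v \<notin> T" using \<delta>(1) zero by fastforce
    moreover have "P (insert v T)"
      using T(1) v far l1norm_minus_commute[of d v] unfolding P_def by auto
    ultimately show False using T(1) T(2)[of "insert v T"] unfolding P_def by simp
  qed
  then show ?thesis
    by (intro that[of T]) (use bound[OF T(1)] T(1) in \<open>auto simp: P_def T0_def image_subset_iff\<close>)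
qed

text \<open>The net is sorted by norm. Shrinking a vector by \<open>\<epsilon> / 2\<close> before approximating it makes the
  approximating point strictly shorter than the vector, so it precedes every point that is at
  least as long as the vector.\<close>

lemma l1_net_sorted:
  fixes \<epsilon> :: real and a d :: nat
  assumes \<epsilon>: "0 < \<epsilon>" "\<epsilon> \<le> 2" and a_def: "a = nat \<lfloor>(1 + 4 / \<epsilon>) ^ d\<rfloor>"
  obtains D where "\<And>k. k < a \<Longrightarrow> l1norm d (D k) \<le> 1"
    "\<And>i. i < d \<Longrightarrow> \<exists>k<a. D k = (\<lambda>j. if j = i then 1 else 0)"
    "\<And>k v. k < a \<Longrightarrow> l1norm d v \<le> l1norm d (D k) \<Longrightarrow>
       \<exists>l\<le>k. l1norm d (\<lambda>j. v j - D l j) \<le> \<epsilon>"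
proof -
  define \<delta> where "\<delta> = \<epsilon> / 2"
  have \<delta>: "0 < \<delta>" "\<delta> \<le> 1" using \<epsilon> by (auto simp: \<delta>_def)
  obtain T where T: "finite T" "real (card T) \<le> (1 + 2 / \<delta>) ^ d" "\<And>x. x \<in> T \<Longrightarrow> l1norm d x \<le> 1"
    "(\<lambda>_. 0) \<in> T" "\<And>i. i < d \<Longrightarrow> (\<lambda>j. if j = i then 1 else 0) \<in> T"
    "\<And>v. l1norm d v \<le> 1 \<Longrightarrow> \<exists>p\<in>T. l1norm d (\<lambda>j. v j - p j) < \<delta>"
    using l1_net_maximal[OF \<delta>, of d] by blast
  have card: "card T \<le> a" using T(2) by (simp add: a_def \<delta>_def le_nat_floor)
  obtain xs where xs: "set xs = T" "length xs = card T"
    using finite_distinct_list[OF T(1)] distinct_card by metis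
  \<comment> \<open>Copies of the zero vector in front bring the length to exactly \<open>a\<close>
    and keep the list sorted.\<close>
  define L where "L = replicate (a - card T) (\<lambda>_. 0) @ sort_key (l1norm d) xs"
  have len: "length L = a" using card xs by (simp add: L_def)
  have setL: "set L = T" using T(4) xs by (auto simp: L_def)
  have zero: "l1norm d (\<lambda>_. 0) = 0" by (simp add: l1norm_def)
  have "sorted (map (l1norm d) L)" by (auto simp: L_def sorted_append zero)
  then have mono: "l1norm d (L ! i) \<le> l1norm d (L ! j)" if "i \<le> j" "j < a" for i j
    using sorted_nth_mono[of "map (l1norm d) L" i j] that len by simp
  have idx: "\<exists>k<a. L ! k = p" if "p \<in> T" for p
    using that setL len by (metis in_set_conv_nth)
  have close: "\<exists>l\<le>k. l1norm d (\<lambda>j. v j - (L ! l) j) \<le> \<epsilon>"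
    if k: "k < a" and v: "l1norm d v \<le> l1norm d (L ! k)" for k v
  proof (cases "l1norm d v \<le> \<delta>")
    \<comment> \<open>So short a vector is approximated by the first entry, which has norm
      \<open>0\<close> and precedes every index.\<close>
    case True
    obtain i where "i < a" "L ! i = (\<lambda>_. 0)" using idx[OF T(4)] by blast
    then have 0: "l1norm d (L ! 0) = 0" using mono[of 0 i] zero l1norm_nonneg[of d "L ! 0"] by simp
    have "l1norm d (\<lambda>j. v j - (L ! 0) j) \<le> l1norm d v + l1norm d (L ! 0)"
      using l1norm_triangle_diff[of d v "L ! 0" "\<lambda>_. 0"] zero l1norm_minus_commute[of d "\<lambda>_. 0" "L ! 0"]
        l1norm_triangle[of d v "\<lambda>j. - (L ! 0) j"] by (simp add: l1norm_def)
    also have "\<dots> \<le> \<epsilon>" using True 0 \<delta>(1) by (simp add: \<delta>_def)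
    finally show ?thesis by blast
  next
    case False
    define n where "n = l1norm d v"
    have n: "\<delta> < n" "0 < n" using False \<delta> by (auto simp: n_def)
    have n1: "n \<le> 1" using v T(3)[of "L ! k"] setL k len unfolding n_def by fastforce
    \<comment> \<open>Shortening by this factor moves \<open>v\<close> by exactly
      \<open>\<delta>\<close>; with a net error below \<open>\<delta>\<close> the total stays within
      \<open>\<epsilon>\<close>.\<close>
    define s where "s = 1 - \<delta> / n"
    have s: "0 \<le> s" "s * n = n - \<delta>" "(1 - s) * n = \<delta>" "s \<le> 1" using n \<delta> by (auto simp: s_def field_simps)
    have ns: "l1norm d (\<lambda>j. s * v j) = n - \<delta>" using l1norm_scale[of d s v] s by (simp add: n_def)
    then obtain p where p: "p \<in> T" "l1norm d (\<lambda>j. s * v j - p j) < \<delta>" using T(6)[of "\<lambda>j. s * v j"] n1 \<delta> by auto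
    obtain l where l: "l < a" "L ! l = p" using idx[OF p(1)] by blast
    have "l1norm d p \<le> l1norm d (\<lambda>j. p j - s * v j) + l1norm d (\<lambda>j. s * v j)"
      using l1norm_triangle[of d "\<lambda>j. p j - s * v j" "\<lambda>j. s * v j"] by simp
    then have "l1norm d p < n" using p(2) ns l1norm_minus_commute[of d p] by simp
    then have "l \<le> k" using mono[of k l] l v unfolding n_def by (meson leI le_less_trans less_imp_le not_less)
    moreover have "l1norm d (\<lambda>j. v j - p j) \<le> \<epsilon>"
    proof -
      have "(\<lambda>j. v j - s * v j) = (\<lambda>j. (1 - s) * v j)" by (simp add: left_diff_distrib)
      then have "l1norm d (\<lambda>j. v j - s * v j) = \<delta>"
        using l1norm_scale[of d "1 - s" v] s by (simp add: n_def)
      then show ?thesis using l1norm_triangle_diff[of d v p "\<lambda>j. s * v j"] p(2) by (simp add: \<delta>_def)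
    qed
    ultimately show ?thesis using l by blast
  qed
  show ?thesis
  proof (rule that[of "\<lambda>k. L ! k"])
    show "l1norm d (L ! k) \<le> 1" if "k < a" for k using T(3) setL len that nth_mem by blast
    show "\<exists>k<a. L ! k = (\<lambda>j. if j = i then 1 else 0)" if "i < d" for i using idx T(5)[OF that] by blast
  qed (rule close)
qed

subsection \<open>Isometric embeddings as matrices\<close>

lemma supnorm_le_iff: "supnorm k x \<le> c \<longleftrightarrow> 0 \<le> c \<and> (\<forall>i<k. \<bar>x i\<bar> \<le> c)"
  by (auto simp: supnorm_def)

lemma supnorm_nonneg: "0 \<le> supnorm k x" and supnorm_ge: "i < k \<Longrightarrow> \<bar>x i\<bar> \<le> supnorm k x"
  using supnorm_le_iff[of k x "supnorm k x"] by auto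

lemma supnorm_attained:
  assumes "supnorm k x \<noteq> 0"
  obtains i where "i < k" "\<bar>x i\<bar> = supnorm k x"
proof -
  have "supnorm k x \<in> insert 0 ((\<lambda>i. \<bar>x i\<bar>) ` {..<k})"
    unfolding supnorm_def by (rule Max_in) auto
  then show ?thesis using that assms by auto
qed

lemma abs_mat_apply_le: "\<bar>mat_apply a M x i\<bar> \<le> l1norm a (M i) * supnorm a x"
proof -
  have "\<bar>mat_apply a M x i\<bar> \<le> (\<Sum>j<a. \<bar>M i j\<bar> * \<bar>x j\<bar>)"
    unfolding mat_apply_def by (rule order_trans[OF sum_abs]) (simp add: abs_mult)
  also have "\<dots> \<le> (\<Sum>j<a. \<bar>M i j\<bar> * supnorm a x)"
    by (intro sum_mono mult_left_mono supnorm_ge) auto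
  finally show ?thesis by (simp add: l1norm_def sum_distrib_right)
qed

lemma l1norm_unit_row:
  assumes "l1norm a x \<le> 1" "\<bar>x j\<bar> = 1" "j < a" "i < a" "i \<noteq> j"
  shows "x i = 0"
proof -
  have "(\<Sum>l\<in>{i, j}. \<bar>x l\<bar>) \<le> l1norm a x"
    unfolding l1norm_def using assms by (intro sum_mono2) auto
  then show ?thesis using assms by simp
qed

text \<open>Testing on the signs of a row bounds that row, and testing on a unit vector yields the
  entry of modulus 1. Conversely, a bounded row with such an entry vanishes elsewhere, so it reads
  off one coordinate up to sign.\<close>

lemma Emb_iff:
  "M \<in> Emb a b \<longleftrightarrow> (\<forall>i j. b \<le> i \<or> a \<le> j \<longrightarrow> M i j = 0) \<and>
     (\<forall>i<b. l1norm a (M i) \<le> 1) \<and> (\<forall>j<a. \<exists>i<b. \<bar>M i j\<bar> = 1)"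
  (is "_ \<longleftrightarrow> ?Z \<and> ?R \<and> ?C")
proof -
  have "?R \<and> ?C" if iso: "\<And>x. supnorm b (mat_apply a M x) = supnorm a x"
  proof (intro conjI allI impI)
    fix i assume i: "i < b"
    define x where "x j = sgn (M i j)" for j
    have "supnorm a x \<le> 1" by (simp add: supnorm_le_iff x_def abs_sgn_eq)
    have "l1norm a (M i) = mat_apply a M x i"
      by (simp add: l1norm_def mat_apply_def x_def abs_sgn)
    also have "\<dots> \<le> supnorm b (mat_apply a M x)" using supnorm_ge[OF i] by (meson abs_le_D1)
    finally show "l1norm a (M i) \<le> 1" using \<open>supnorm a x \<le> 1\<close> iso by simp
  next
    fix j assume j: "j < a"
    define x where "x = (\<lambda>l. if l = j then 1 else 0 :: real)"
    have Mx: "mat_apply a M x i = M i j" for i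
      using j by (simp add: mat_apply_def x_def if_distrib cong: if_cong)
    have "supnorm a x \<le> 1" by (simp add: supnorm_le_iff x_def)
    moreover have "1 \<le> supnorm a x" using supnorm_ge[OF j, of x] by (simp add: x_def)
    ultimately have 1: "supnorm b (mat_apply a M x) = 1" using iso by simp
    then show "\<exists>i<b. \<bar>M i j\<bar> = 1" using supnorm_attained[of b "mat_apply a M x"] Mx by auto
  qed
  moreover have "supnorm b (mat_apply a M x) = supnorm a x" if R: ?R and C: ?C for x
  proof (rule antisym)
    have "\<bar>mat_apply a M x i\<bar> \<le> supnorm a x" if "i < b" for i
    proof -
      have "l1norm a (M i) * supnorm a x \<le> 1 * supnorm a x"
        using R that by (intro mult_right_mono supnorm_nonneg) auto
      then show ?thesis using abs_mat_apply_le[of a M x i] by simp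
    qed
    then show "supnorm b (mat_apply a M x) \<le> supnorm a x"
      by (simp add: supnorm_le_iff supnorm_nonneg)
    have "\<bar>x j\<bar> \<le> supnorm b (mat_apply a M x)" if j: "j < a" for j
    proof -
      obtain i where i: "i < b" "\<bar>M i j\<bar> = 1" using C j by blast
      have "M i l * x l = (if l = j then M i j * x j else 0)" if "l < a" for l
        using l1norm_unit_row[of a "M i" j l] R i j that by auto
      then have "mat_apply a M x i = (\<Sum>l<a. if l = j then M i j * x j else 0)"
        unfolding mat_apply_def by (intro sum.cong) auto
      then have "mat_apply a M x i = M i j * x j" using j by simp
      then show ?thesis using supnorm_ge[OF i(1), of "mat_apply a M x"] i(2) by (simp add: abs_mult)
    qed
    then show "supnorm a x \<le> supnorm b (mat_apply a M x)"
      by (simp add: supnorm_le_iff supnorm_nonneg)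
  qed
  ultimately have "(\<forall>x. supnorm b (mat_apply a M x) = supnorm a x) \<longleftrightarrow> ?R \<and> ?C" by blast
  then show ?thesis unfolding Emb_def by simp
qed

text \<open>Each row acts as a functional whose norm, dual to the supremum norm, is bounded by the
  sum norm.\<close>

lemma opdist_le:
  assumes "\<And>i. i < b \<Longrightarrow> l1norm a (\<lambda>j. M i j - N i j) \<le> e" "0 \<le> e"
  shows "opdist a b M N \<le> e"
  unfolding opdist_def opnorm_def
proof (rule cSup_least)
  have "supnorm a (\<lambda>_. 0) \<le> 1" by (simp add: supnorm_le_iff)
  then show "{supnorm b (mat_apply a (\<lambda>i j. M i j - N i j) x) |x. supnorm a x \<le> 1} \<noteq> {}" by blast
  fix y assume "y \<in> {supnorm b (mat_apply a (\<lambda>i j. M i j - N i j) x) |x. supnorm a x \<le> 1}"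
  then obtain x where x: "supnorm a x \<le> 1" and y: "y = supnorm b (mat_apply a (\<lambda>i j. M i j - N i j) x)"
    by blast
  have "\<bar>mat_apply a (\<lambda>i j. M i j - N i j) x i\<bar> \<le> e" if "i < b" for i
  proof -
    have "\<bar>mat_apply a (\<lambda>i j. M i j - N i j) x i\<bar> \<le> l1norm a (\<lambda>j. M i j - N i j) * supnorm a x"
      by (rule abs_mat_apply_le)
    also have "\<dots> \<le> l1norm a (\<lambda>j. M i j - N i j) * 1" by (intro mult_left_mono x) simp
    finally show ?thesis using assms(1)[OF that] by simp
  qed
  then show "y \<le> e" using assms(2) by (simp add: y supnorm_le_iff)
qed

text \<open>The adjoint of a contraction is a contraction. This serves both for composition with an
  embedding and for \<open>place\<close>.\<close>

lemma l1norm_row_mult_le: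
  assumes "\<And>k. k < m \<Longrightarrow> l1norm d (A k) \<le> 1"
  shows "l1norm d (\<lambda>j. \<Sum>k<m. p k * A k j) \<le> l1norm m p"
proof -
  have "l1norm d (\<lambda>j. \<Sum>k<m. p k * A k j) \<le> (\<Sum>j<d. \<Sum>k<m. \<bar>p k\<bar> * \<bar>A k j\<bar>)"
    unfolding l1norm_def by (intro sum_mono order_trans[OF sum_abs]) (simp add: abs_mult)
  also have "\<dots> = (\<Sum>k<m. \<bar>p k\<bar> * l1norm d (A k))"
    by (subst sum.swap) (simp add: l1norm_def sum_distrib_left)
  also have "\<dots> \<le> (\<Sum>k<m. \<bar>p k\<bar> * 1)"
    using assms by (intro sum_mono mult_left_mono) auto
  finally show ?thesis by (simp add: l1norm_def)
qed

lemma coordinate_embedding: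
  assumes "m \<le> n"
  shows "(\<lambda>i j. if i = j \<and> j < m then 1 else 0) \<in> Emb m n"
proof -
  have "l1norm m (\<lambda>j. if i = j \<and> j < m then 1 else 0) \<le> 1" for i
  proof -
    have "l1norm m (\<lambda>j. if i = j \<and> j < m then 1 else 0) = (\<Sum>j<m. if i = j then 1 else 0)"
      unfolding l1norm_def by (intro sum.cong) auto
    then show ?thesis by simp
  qed
  then show ?thesis using assms unfolding Emb_iff by fastforce
qed

lemma Epi_image: "f \<in> Epi n a \<Longrightarrow> f ` {..<n} = {..<a}"
  by (simp add: Epi_def)

lemma Epi_le: "f \<in> Epi n a \<Longrightarrow> a \<le> n"
  using card_image_le[of "{..<n}" f] by (simp add: Epi_image)

text \<open>Any two embeddings are at distance at most 2, so a single \<open>N\<close> serves all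
  \<open>\<phi>\<close>. The net construction covers only \<open>\<epsilon> \<le> 2\<close>.\<close>

lemma emb_ramsey_large_radius:
  assumes "d \<le> m" "m \<le> n" "2 \<le> \<epsilon>"
  shows "emb_ramsey d m r \<epsilon> n"
  unfolding emb_ramsey_def
proof (intro allI impI)
  fix c assume c: "\<forall>M\<in>Emb d n. c M < r"
  obtain \<gamma> where \<gamma>: "\<gamma> \<in> Emb m n" using coordinate_embedding[OF assms(2)] by blast
  obtain N where N: "N \<in> Emb d n" using coordinate_embedding[of d n] assms by force
  have "opdist d n (mat_comp m \<gamma> \<phi>) N \<le> \<epsilon>" if \<phi>: "\<phi> \<in> Emb d m" for \<phi>
  proof (rule opdist_le)
    fix i assume i: "i < n"
    have "l1norm d (mat_comp m \<gamma> \<phi> i) \<le> l1norm m (\<gamma> i)"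
      unfolding mat_comp_def by (rule l1norm_row_mult_le) (use \<phi> in \<open>simp add: Emb_iff\<close>)
    also have "\<dots> \<le> 1" using \<gamma> i by (simp add: Emb_iff)
    finally have "l1norm d (mat_comp m \<gamma> \<phi> i) \<le> 1" .
    moreover have "l1norm d (\<lambda>j. - N i j) \<le> 1" using N i by (simp add: Emb_iff l1norm_def)
    moreover have "l1norm d (\<lambda>j. mat_comp m \<gamma> \<phi> i j - N i j) \<le>
        l1norm d (mat_comp m \<gamma> \<phi> i) + l1norm d (\<lambda>j. - N i j)"
      using l1norm_triangle[of d "mat_comp m \<gamma> \<phi> i" "\<lambda>j. - N i j"] by simp
    ultimately show "l1norm d (\<lambda>j. mat_comp m \<gamma> \<phi> i j - N i j) \<le> \<epsilon>" using assms(3) by linarith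
  qed (use assms(3) in simp)
  then show "\<exists>\<gamma>\<in>Emb m n. \<exists>i<r. \<forall>\<phi>\<in>Emb d m. \<exists>N\<in>Emb d n. c N = i \<and> opdist d n (mat_comp m \<gamma> \<phi>) N \<le> \<epsilon>"
    using c N \<gamma> by blast
qed

subsection \<open>Signed injections\<close>

text \<open>Extensional sign functions and distinct lists make this set finite, with both factors
  counted by library facts.\<close>

definition signed_injections :: "nat \<Rightarrow> nat \<Rightarrow> ((nat \<Rightarrow> real) \<times> nat list) set" where
  "signed_injections d m =
     ({..<d} \<rightarrow>\<^sub>E {1, -1}) \<times> {\<iota>. length \<iota> = d \<and> distinct \<iota> \<and> set \<iota> \<subseteq> {..<m}}"

lemma card_signed_injections:
  assumes "d \<le> m"
  shows "card (signed_injections d m) = 2 ^ d * (fact m div fact (m - d))"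
    "finite (signed_injections d m)"
proof -
  have "card {\<iota>. length \<iota> = d \<and> distinct \<iota> \<and> set \<iota> \<subseteq> {..<m}} = fact m div fact (m - d)"
    using card_lists_distinct_length_eq[of "{..<m}" d] assms by (simp add: fact_div_fact)
  moreover have "card {1, -1 :: real} = 2" by simp
  ultimately show "card (signed_injections d m) = 2 ^ d * (fact m div fact (m - d))"
    by (simp add: signed_injections_def card_cartesian_product card_PiE numeral_2_eq_2)
  show "finite (signed_injections d m)"
    unfolding signed_injections_def
    by (intro finite_cartesian_product finite_PiE finite_subset[OF _ finite_lists_length_eq[of "{..<m}" d]]) auto
qed

text \<open>The linear map that sends the \<open>j\<close>-th unit vector to the unit vector at
  \<open>snd \<sigma> ! j\<close> with sign \<open>fst \<sigma> j\<close>.\<close>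

definition place :: "nat \<Rightarrow> (nat \<Rightarrow> real) \<times> nat list \<Rightarrow> (nat \<Rightarrow> real) \<Rightarrow> nat \<Rightarrow> real" where
  "place d \<sigma> p k = (\<Sum>j<d. p j * (if snd \<sigma> ! j = k then fst \<sigma> j else 0))"

lemma l1norm_place_le:
  assumes "\<sigma> \<in> signed_injections d m"
  shows "l1norm m (place d \<sigma> p) \<le> l1norm d p"
  unfolding place_def
proof (rule l1norm_row_mult_le)
  fix j assume j: "j < d"
  have "l1norm m (\<lambda>k. if snd \<sigma> ! j = k then fst \<sigma> j else 0) =
      (\<Sum>k<m. if snd \<sigma> ! j = k then \<bar>fst \<sigma> j\<bar> else 0)"
    unfolding l1norm_def by (intro sum.cong) auto
  also have "\<dots> \<le> \<bar>fst \<sigma> j\<bar>" by simp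
  also have "fst \<sigma> j \<in> {1, -1}" using assms j by (auto simp: signed_injections_def PiE_iff)
  then have "\<bar>fst \<sigma> j\<bar> = 1" by auto
  finally show "l1norm m (\<lambda>k. if snd \<sigma> ! j = k then fst \<sigma> j else 0) \<le> 1" by simp
qed

lemma place_mult:
  assumes "\<sigma> \<in> signed_injections d m"
  shows "(\<Sum>k<m. place d \<sigma> p k * A k i) = (\<Sum>j<d. p j * (fst \<sigma> j * A (snd \<sigma> ! j) i))"
proof -
  have "(\<Sum>k<m. place d \<sigma> p k * A k i) =
      (\<Sum>j<d. \<Sum>k<m. p j * (if snd \<sigma> ! j = k then fst \<sigma> j else 0) * A k i)"
    unfolding place_def sum_distrib_right by (rule sum.swap)
  also have "\<dots> = (\<Sum>j<d. p j * (fst \<sigma> j * A (snd \<sigma> ! j) i))"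
  proof (rule sum.cong[OF refl])
    fix j assume "j \<in> {..<d}"
    then have j: "snd \<sigma> ! j < m" using assms nth_mem by (fastforce simp: signed_injections_def)
    have "(\<Sum>k<m. p j * (if snd \<sigma> ! j = k then fst \<sigma> j else 0) * A k i) =
        (\<Sum>k<m. if snd \<sigma> ! j = k then p j * (fst \<sigma> j * A k i) else 0)"
      by (intro sum.cong) auto
    then show "(\<Sum>k<m. p j * (if snd \<sigma> ! j = k then fst \<sigma> j else 0) * A k i) =
        p j * (fst \<sigma> j * A (snd \<sigma> ! j) i)" using j by simp
  qed
  finally show ?thesis .
qed

lemma place_unit:
  assumes "\<sigma> \<in> signed_injections d m" "0 < d"
  shows "\<bar>place d \<sigma> (\<lambda>j. if j = 0 then 1 else 0) (snd \<sigma> ! 0)\<bar> = 1"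
proof -
  have "place d \<sigma> (\<lambda>j. if j = 0 then 1 else 0) (snd \<sigma> ! 0) = (\<Sum>j<d. if j = 0 then fst \<sigma> 0 else 0)"
    unfolding place_def by (intro sum.cong) auto
  moreover have "fst \<sigma> 0 \<in> {1, -1}" using assms by (auto simp: signed_injections_def PiE_iff)
  ultimately show ?thesis using assms(2) by auto
qed

text \<open>Together with \<open>place_unit\<close> this puts an entry of modulus 1 into every
  column of the matrix formed by all placements.\<close>

lemma signed_injection_through:
  assumes "d \<le> m" "i < m" "0 < d"
  shows "\<exists>\<sigma>\<in>signed_injections d m. snd \<sigma> ! 0 = i"
proof -
  define \<iota> where "\<iota> = i # take (d - 1) (filter (\<lambda>j. j \<noteq> i) [0..<m])"
  have "length (filter (\<lambda>j. j \<noteq> i) [0..<m]) = card ({0..<m} - {i})"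
    by (subst distinct_card[symmetric]) (auto intro!: arg_cong[of _ _ card])
  then have "length \<iota> = d" using assms by (simp add: \<iota>_def)
  moreover have "distinct \<iota>" "set \<iota> \<subseteq> {..<m}"
    using assms by (auto simp: \<iota>_def dest: in_set_takeD)
  ultimately have "((\<lambda>j\<in>{..<d}. 1), \<iota>) \<in> signed_injections d m"
    by (auto simp: signed_injections_def)
  then show ?thesis by (rule bexI[rotated]) (simp add: \<iota>_def)
qed

text \<open>For each column \<open>j\<close> a row \<open>g j\<close> with entry 1 or -1 is chosen.
  That row vanishes elsewhere, so \<open>g\<close> is injective, and placing along \<open>g\<close>
  with these signs is undone by multiplication with \<open>\<phi>\<close>.\<close>

lemma embedding_signed_injection:
  assumes \<phi>: "\<phi> \<in> Emb d m"
  obtains \<sigma> where "\<sigma> \<in> signed_injections d m"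
    "\<And>p i. i < d \<Longrightarrow> (\<Sum>k<m. place d \<sigma> p k * \<phi> k i) = p i"
proof -
  have "\<forall>j\<in>{..<d}. \<exists>k<m. \<bar>\<phi> k j\<bar> = 1" using \<phi> by (simp add: Emb_iff)
  then obtain g where g: "\<And>j. j < d \<Longrightarrow> g j < m" "\<And>j. j < d \<Longrightarrow> \<bar>\<phi> (g j) j\<bar> = 1"
    by (metis lessThan_iff)
  have off: "\<phi> (g j) i = 0" if "j < d" "i < d" "i \<noteq> j" for i j
    using l1norm_unit_row[of d "\<phi> (g j)" j i] \<phi> g that by (simp add: Emb_iff)
  define \<iota> s where "\<iota> = map g [0..<d]" and "s = (\<lambda>j\<in>{..<d}. \<phi> (g j) j)"
  have "inj_on g {0..<d}"
  proof (rule inj_onI)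
    fix x y assume xy: "x \<in> {0..<d}" "y \<in> {0..<d}" "g x = g y"
    then show "x = y" using off[of x y] g(2)[of y] by fastforce
  qed
  then have "distinct \<iota>" by (simp add: \<iota>_def distinct_map)
  moreover have "s j \<in> {1, -1}" if "j < d" for j
    using g(2)[OF that] that by (auto simp: s_def abs_if split: if_splits)
  ultimately have \<sigma>: "(s, \<iota>) \<in> signed_injections d m"
    using g(1) by (auto simp: signed_injections_def \<iota>_def s_def)
  have "(\<Sum>k<m. place d (s, \<iota>) p k * \<phi> k i) = p i" if i: "i < d" for p i
  proof -
    have "(\<Sum>k<m. place d (s, \<iota>) p k * \<phi> k i) = (\<Sum>j<d. if j = i then p i else 0)"
      unfolding place_mult[OF \<sigma>]
    proof (rule sum.cong[OF refl])
      fix j assume "j \<in> {..<d}"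
      moreover have "\<phi> (g i) i * \<phi> (g i) i = 1"
        using g(2)[OF i] by (metis abs_mult_self_eq mult.right_neutral)
      ultimately show "p j * (fst (s, \<iota>) j * \<phi> (snd (s, \<iota>) ! j) i) = (if j = i then p i else 0)"
        using off[of j i] i by (simp add: s_def \<iota>_def)
    qed
    then show ?thesis using i by simp
  qed
  then show ?thesis using that[OF \<sigma>] by blast
qed

section \<open>Transfer from rigid surjections to embeddings\<close>

text \<open>The value \<open>k\<close> cannot occur before the block of length \<open>S\<close> with
  index \<open>k\<close>, and it does occur there at offset \<open>q0\<close>, so the first
  occurrences are ordered like the blocks.\<close>

lemma block_Epi:
  assumes S: "q0 < S" and le: "\<And>q. q < a * S \<Longrightarrow> f q \<le> q div S"
    and eq: "\<And>q. q < a * S \<Longrightarrow> q mod S = q0 \<Longrightarrow> f q = q div S"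
    and zero: "\<And>q. a * S \<le> q \<Longrightarrow> f q = 0"
  shows "f \<in> Epi (a * S) a"
proof -
  have rep: "k * S + q0 < a * S" "f (k * S + q0) = k" if "k < a" for k
  proof -
    have "k * S + q0 < Suc k * S" using S by simp
    also have "\<dots> \<le> a * S" using that by (intro mult_le_mono1) simp
    finally show "k * S + q0 < a * S" .
    then show "f (k * S + q0) = k" using eq[of "k * S + q0"] S by simp
  qed
  have "f q < a" if "q < a * S" for q
    using le[OF that] less_mult_imp_div_less[OF that] by linarith
  then have "f ` {..<a * S} = {..<a}" using rep by (force simp: image_iff)
  moreover have "Min {j. j < a * S \<and> f j = s0} < Min {j. j < a * S \<and> f j = s1}"
    if s: "s0 < s1" "s1 < a" for s0 s1
  proof -
    have "Min {j. j < a * S \<and> f j = s0} \<le> s0 * S + q0" using rep[of s0] s by (intro Min_le) auto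
    also have "\<dots> < Suc s0 * S" using S by simp
    also have "\<dots> \<le> s1 * S" using s by (intro mult_le_mono1) simp
    also have "\<dots> \<le> Min {j. j < a * S \<and> f j = s1}"
    proof -
      have "Min {j. j < a * S \<and> f j = s1} \<in> {j. j < a * S \<and> f j = s1}"
        using rep[of s1] s by (intro Min_in) auto
      then have "s1 \<le> Min {j. j < a * S \<and> f j = s1} div S" using le by force
      then show ?thesis using S by (simp add: less_eq_div_iff_mult_less_eq)
    qed
    finally show ?thesis .
  qed
  ultimately show ?thesis using zero by (simp add: Epi_def)
qed

text \<open>One \<open>\<gamma>\<close> serves all \<open>\<phi>\<close>; only the rigid surjection
  \<open>f\<close> composed with it depends on \<open>\<phi>\<close>.\<close>

lemma emb_ramsey_small_radius:
  assumes d: "0 < d" "d \<le> m" and \<epsilon>: "0 < \<epsilon>" "\<epsilon> \<le> 2" and r: "0 < r"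
    and a: "a = nat \<lfloor>(1 + 4 / \<epsilon>) ^ d\<rfloor>" and S: "S = card (signed_injections d m)"
    and gr: "gr_prop a (a * S) r n"
  shows "emb_ramsey d m r \<epsilon> n"
  unfolding emb_ramsey_def
proof (intro allI impI)
  fix c :: "(nat \<Rightarrow> nat \<Rightarrow> real) \<Rightarrow> nat" assume c: "\<forall>M\<in>Emb d n. c M < r"
  obtain D where D: "\<And>k. k < a \<Longrightarrow> l1norm d (D k) \<le> 1"
    "\<And>i. i < d \<Longrightarrow> \<exists>k<a. D k = (\<lambda>j. if j = i then 1 else 0)"
    "\<And>k v. k < a \<Longrightarrow> l1norm d v \<le> l1norm d (D k) \<Longrightarrow> \<exists>l\<le>k. l1norm d (\<lambda>j. v j - D l j) \<le> \<epsilon>"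
    using l1_net_sorted[OF \<epsilon> a] by blast
  obtain h where h: "bij_betw h {0..<S} (signed_injections d m)"
    using ex_bij_betw_nat_finite[OF card_signed_injections(2)[OF d(2)]] S by blast
  have hS: "h q \<in> signed_injections d m" if "q < S" for q using h that by (auto simp: bij_betw_def)
  have hsurj: "\<exists>q<S. h q = \<sigma>" if "\<sigma> \<in> signed_injections d m" for \<sigma>
    using h that by (force simp: bij_betw_def image_iff)
  have "0 < S" using signed_injection_through[OF d(2), of 0] d S card_signed_injections(2)[OF d(2)]
    by (auto simp: card_gt_0_iff)
  \<comment> \<open>The net index is the block \<open>q div S\<close> and the signed injection is
    the offset, so all copies of a net point come before the copies of the next one.\<close>
  define P where "P q = place d (h (q mod S)) (D (q div S))" for q
  have P: "l1norm m (P q) \<le> l1norm d (D (q div S))" for q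
    unfolding P_def using hS \<open>0 < S\<close> by (intro l1norm_place_le) simp
  have qa: "q div S < a" if "q < a * S" for q using that by (rule less_mult_imp_div_less)
  define rows where "rows g = (\<lambda>i j. if i < n \<and> j < d then D (g i) j else 0)" for g
  have rows: "rows g \<in> Emb d n" if g: "g ` {..<n} = {..<a}" for g
    unfolding Emb_iff
  proof (intro conjI allI impI)
    fix i assume i: "i < n"
    have "l1norm d (rows g i) = l1norm d (D (g i))" using i by (intro l1norm_cong) (simp add: rows_def)
    then show "l1norm d (rows g i) \<le> 1" using D(1)[of "g i"] g i by auto
  next
    fix j assume j: "j < d"
    obtain k where "k < a" "D k = (\<lambda>i. if i = j then 1 else 0)" using D(2)[OF j] by blast
    moreover from this have "k \<in> g ` {..<n}" using g by simp
    then obtain i where "i < n" "g i = k" by blast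
    ultimately show "\<exists>i<n. \<bar>rows g i j\<bar> = 1" using j by (intro exI[of _ i]) (simp add: rows_def)
  qed (auto simp: rows_def)
  have "\<forall>g\<in>Epi n a. c (rows g) < r" using c rows Epi_image by blast
  then obtain \<gamma> i where \<gamma>: "\<gamma> \<in> Epi n (a * S)"
    and mono: "\<And>f. f \<in> Epi (a * S) a \<Longrightarrow> c (rows (epi_comp n f \<gamma>)) = i"
    using gr[unfolded gr_prop_def, rule_format, of "\<lambda>g. c (rows g)"] by auto
  define \<Gamma> where "\<Gamma> = (\<lambda>i k. if i < n \<and> k < m then P (\<gamma> i) k else 0)"
  have \<gamma>b: "\<gamma> i < a * S" if "i < n" for i using Epi_image[OF \<gamma>] that by auto
  have \<Gamma>: "\<Gamma> \<in> Emb m n"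
    unfolding Emb_iff
  proof (intro conjI allI impI)
    fix i assume i: "i < n"
    have "l1norm m (\<Gamma> i) = l1norm m (P (\<gamma> i))" using i by (intro l1norm_cong) (simp add: \<Gamma>_def)
    then show "l1norm m (\<Gamma> i) \<le> 1" using P[of "\<gamma> i"] D(1)[OF qa[OF \<gamma>b[OF i]]] by simp
  next
    fix j assume j: "j < m"
    obtain \<sigma> where \<sigma>: "\<sigma> \<in> signed_injections d m" "snd \<sigma> ! 0 = j"
      using signed_injection_through[OF d(2) j d(1)] by blast
    obtain q where q: "q < S" "h q = \<sigma>" using hsurj \<sigma>(1) by blast
    \<comment> \<open>The first unit vector, placed so that its coordinate goes to \<open>j\<close>,
      provides the entry of modulus 1 in column \<open>j\<close>.\<close>
    obtain k where k: "k < a" "D k = (\<lambda>i. if i = 0 then 1 else 0)" using D(2)[OF d(1)] by blast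
    have "k * S + q < Suc k * S" using q by simp
    also have "\<dots> \<le> a * S" using k by (intro mult_le_mono1) simp
    finally have "k * S + q \<in> \<gamma> ` {..<n}" using Epi_image[OF \<gamma>] by simp
    then obtain i where i: "i < n" "\<gamma> i = k * S + q" by force
    have "P (k * S + q) = place d \<sigma> (\<lambda>i. if i = 0 then 1 else 0)" using q k by (simp add: P_def)
    then have "\<bar>\<Gamma> i j\<bar> = 1" using place_unit[OF \<sigma>(1) d(1)] \<sigma>(2) i j by (simp add: \<Gamma>_def)
    then show "\<exists>i<n. \<bar>\<Gamma> i j\<bar> = 1" using i by blast
  qed (auto simp: \<Gamma>_def)
  have near: "\<exists>N\<in>Emb d n. c N = i \<and> opdist d n (mat_comp m \<Gamma> \<phi>) N \<le> \<epsilon>" if \<phi>: "\<phi> \<in> Emb d m" for \<phi>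
  proof -
    obtain \<sigma> where \<sigma>: "\<sigma> \<in> signed_injections d m"
      "\<And>p i. i < d \<Longrightarrow> (\<Sum>k<m. place d \<sigma> p k * \<phi> k i) = p i"
      using embedding_signed_injection[OF \<phi>] by blast
    obtain q0 where q0: "q0 < S" "h q0 = \<sigma>" using hsurj \<sigma>(1) by blast
    define Q where "Q q j = (\<Sum>k<m. P q k * \<phi> k j)" for q j
    have "l1norm d (Q q) \<le> l1norm d (D (q div S))" for q
      unfolding Q_def using \<phi> by (intro order_trans[OF l1norm_row_mult_le P]) (simp add: Emb_iff)
    then have ex: "\<exists>l\<le>q div S. l1norm d (\<lambda>j. Q q j - D l j) \<le> \<epsilon>" if "q < a * S" for q
      using D(3) qa[OF that] by blast
    \<comment> \<open>At offset \<open>q0\<close> multiplication with \<open>\<phi>\<close> returns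
      the net point itself, so its own index is exact there. Elsewhere an index no larger is chosen,
      and the value \<open>0\<close> outside the range is the convention of
      \<open>Epi\<close>.\<close>
    define f where "f q = (if a * S \<le> q then 0 else if q mod S = q0 then q div S
        else (SOME l. l \<le> q div S \<and> l1norm d (\<lambda>j. Q q j - D l j) \<le> \<epsilon>))" for q
    have f: "f q \<le> q div S \<and> l1norm d (\<lambda>j. Q q j - D (f q) j) \<le> \<epsilon>" if q: "q < a * S" for q
    proof (cases "q mod S = q0")
      case True
      have "Q q j = D (q div S) j" if "j < d" for j
        using \<sigma>(2)[OF that] True q0 by (simp add: Q_def P_def)
      then have "l1norm d (\<lambda>j. Q q j - D (q div S) j) = l1norm d (\<lambda>_. 0)" by (intro l1norm_cong) simp
      then show ?thesis using True q \<epsilon> by (simp add: f_def l1norm_def)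
    next
      case False
      then show ?thesis using someI_ex[OF ex[OF q]] q by (simp add: f_def)
    qed
    have fE: "f \<in> Epi (a * S) a" by (rule block_Epi[OF q0(1)]) (use f in \<open>auto simp: f_def\<close>)
    have "epi_comp n f \<gamma> ` {..<n} = f ` \<gamma> ` {..<n}" unfolding image_image
      by (rule image_cong) (auto simp: epi_comp_def)
    then have "epi_comp n f \<gamma> ` {..<n} = {..<a}" using Epi_image[OF \<gamma>] Epi_image[OF fE] by simp
    then have "rows (epi_comp n f \<gamma>) \<in> Emb d n" by (rule rows)
    moreover have "opdist d n (mat_comp m \<Gamma> \<phi>) (rows (epi_comp n f \<gamma>)) \<le> \<epsilon>"
    proof (rule opdist_le)
      fix i assume i: "i < n"
      have "l1norm d (\<lambda>j. mat_comp m \<Gamma> \<phi> i j - rows (epi_comp n f \<gamma>) i j) =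
          l1norm d (\<lambda>j. Q (\<gamma> i) j - D (f (\<gamma> i)) j)"
        using i by (intro l1norm_cong) (simp add: mat_comp_def \<Gamma>_def Q_def rows_def epi_comp_def)
      then show "l1norm d (\<lambda>j. mat_comp m \<Gamma> \<phi> i j - rows (epi_comp n f \<gamma>) i j) \<le> \<epsilon>"
        using f[OF \<gamma>b[OF i]] by simp
    qed (use \<epsilon> in simp)
    ultimately show ?thesis using mono[OF fE] by blast
  qed
  \<comment> \<open>\<open>gr_prop\<close> does not bound the colour \<open>i\<close>; it is below
    \<open>r\<close> because some embedding of that colour exists.\<close>
  obtain \<phi> where "\<phi> \<in> Emb d m" using coordinate_embedding[OF d(2)] by blast
  then have "i < r" using near c by blast
  then show "\<exists>\<gamma>\<in>Emb m n. \<exists>i<r. \<forall>\<phi>\<in>Emb d m. \<exists>N\<in>Emb d n. c N = i \<and>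
      opdist d n (mat_comp m \<gamma> \<phi>) N \<le> \<epsilon>" using \<Gamma> near by blast
qed

text \<open>The quotient is a product whose largest factor is \<open>m\<close>. The bound supplies
  \<open>m \<le> n\<close> when \<open>\<epsilon>\<close> exceeds 2.\<close>

lemma le_falling_factorial:
  assumes "0 < d" "d \<le> m"
  shows "m \<le> fact m div (fact (m - d) :: nat)"
proof -
  obtain m' where m: "m = Suc m'" using assms by (cases m) auto
  have "fact (m - d) dvd (fact m' :: nat)" using assms m by (intro fact_dvd) simp
  then have "fact m div (fact (m - d) :: nat) = m * (fact m' div fact (m - d))"
    by (simp add: m div_mult_swap)
  moreover have "0 < fact m' div (fact (m - d) :: nat)"
    using assms m by (simp add: div_greater_zero_iff fact_mono)
  ultimately show ?thesis by simp
qed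

text \<open>By minimality of \<open>n_inf\<close> it suffices that the value of \<open>GR\<close>
  has the embedding property; \<open>graham_rothschild\<close> guarantees that this value satisfies
  \<open>gr_prop\<close>.\<close>

theorem theorem6p27:
  fixes d m r :: nat and \<epsilon> :: real
  assumes "0 < d" and "d \<le> m" and "0 < r" and "0 < \<epsilon>"
  shows "n_inf d m r \<epsilon> \<le>
           GR (nat \<lfloor>(1 + 4 / \<epsilon>) ^ d\<rfloor>)
              (nat \<lfloor>(1 + 4 / \<epsilon>) ^ d\<rfloor> * 2 ^ d * (fact m div fact (m - d)))
              r"
proof -
  define a where "a = nat \<lfloor>(1 + 4 / \<epsilon>) ^ d\<rfloor>"
  define S where "S = card (signed_injections d m)"
  have S: "S = 2 ^ d * (fact m div fact (m - d))"
    unfolding S_def by (rule card_signed_injections(1)[OF assms(2)])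
  define n where "n = GR a (a * S) r"
  have gr: "gr_prop a (a * S) r n"
    unfolding n_def GR_def by (rule LeastI_ex) (rule graham_rothschild[OF assms(3)])
  have "emb_ramsey d m r \<epsilon> n"
  proof (cases "\<epsilon> \<le> 2")
    case True
    then show ?thesis by (rule emb_ramsey_small_radius[OF assms(1,2,4) _ assms(3) a_def S_def gr])
  next
    case False
    have "1 \<le> (1 + 4 / \<epsilon>) ^ d" using assms(4) by (intro one_le_power) simp
    then have "1 \<le> a" by (simp add: a_def le_nat_floor)
    have "m \<le> fact m div fact (m - d)" by (rule le_falling_factorial[OF assms(1,2)])
    also have "\<dots> \<le> a * S" using \<open>1 \<le> a\<close> by (simp add: S)
    \<comment> \<open>A constant colouring yields a rigid surjection from \<open>n\<close> onto
      \<open>a * S\<close>, which forces the inequality.\<close>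
    also have "\<dots> \<le> n"
      using gr[unfolded gr_prop_def, rule_format, of "\<lambda>_. 0"] assms(3) Epi_le by blast
    finally show ?thesis using emb_ramsey_large_radius[OF assms(2)] False by simp
  qed
  then have "n_inf d m r \<epsilon> \<le> n" unfolding n_inf_def by (rule Least_le)
  then show ?thesis by (simp add: n_def a_def S mult.assoc)
qed

end
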